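(* Let $N$ be a positive integer and let $a,b\in\mathbb{R}$ satisfy $0\le b<\frac{N-2}{2}$ and $a\le\frac{Nb}{N-2}$. There exists a constant $C_1(N,a,b)>0$, depending only on $N,a,b$, such that for all $u\in X_{a,b}$, $$\int_{\mathbb{R}^N}\frac{|\nabla u|^2}{|x|^{2b}}dx+\int_{\mathbb{R}^N}\frac{|u|^2}{|x|^{2a}}dx-(N-a-b-1)\int_{\mathbb{R}^N}\frac{|u|^2}{|x|^{a+b+1}}dx\ \ge\ C_1(N,a,b)\inf_{c\in\mathbb{R}}\int_{\mathbb{R}^N}\frac{\left|u-ce^{-\frac1{b+1-a}|x|^{b+1-a}}\right|^2}{|x|^{\frac{2bN}{N-2}}}dx.$$ Furthermore, if $a+b+1=\frac{2bN}{N-2}$, then there exists a constant $C_2(N,a,b)>0$, depending only on $N,a,b$, such that for all $u\in X_{a,b}$, $$\delta_{1,a,b}(u)\ \ge\ C_2(N,a,b)\inf_{v\in E_{a,b}}\int_{\mathbb{R}^N}\frac{|u-v|^2}{|x|^{a+b+1}}dx.$$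
   Context: All functions are real-valued. $X_{a,b}$ denotes the completion of $C_0^\infty(\mathbb{R}^N)$ under the norm $\left(\int_{\mathbb{R}^N}\frac{|\nabla u|^2}{|x|^{2b}}dx+\int_{\mathbb{R}^N}\frac{|u|^2}{|x|^{2a}}dx\right)^{1/2}$. Further $$\delta_{1,a,b}(u):=\left(\int_{\mathbb{R}^N}\frac{|u|^2}{|x|^{2a}}dx\right)^{\frac12}\left(\int_{\mathbb{R}^N}\frac{|\nabla u|^2}{|x|^{2b}}dx\right)^{\frac12}-\left|\frac{N-a-b-1}{2}\right|\int_{\mathbb{R}^N}\frac{|u|^2}{|x|^{a+b+1}}dx$$ and $$E_{a,b}=\left\{v(x)=\alpha\exp\left(-\tfrac{\beta}{b+1-a}|x|^{b+1-a}\right):\ \alpha\in\mathbb{R},\ \beta>0\right\}.$$ *)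

theory Defs
  imports "HOL-Analysis.Analysis"
begin

definition grad :: "(real^'n \<Rightarrow> real) \<Rightarrow> real^'n \<Rightarrow> real^'n" where
  "grad f x = (\<chi> i. frechet_derivative f (at x) (axis i 1))"

primrec C_k :: "nat \<Rightarrow> (real^'n \<Rightarrow> real) \<Rightarrow> bool" where
  "C_k 0 f \<longleftrightarrow> continuous_on UNIV f"
| "C_k (Suc k) f \<longleftrightarrow> f differentiable_on UNIV \<and> (\<forall>i. C_k k (\<lambda>x. grad f x $ i))"

definition test_function :: "(real^'n \<Rightarrow> real) \<Rightarrow> bool" where
  "test_function f \<longleftrightarrow> (\<forall>k. C_k k f) \<and> compact (closure {x. f x \<noteq> 0})"

text \<open>
  The completion of the test functions under the weighted norm, realised as the closure of
  the set of all pairs of a test function and its gradient in the product of the weighted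
  L2 spaces with weights \<open>|x|^(-2a)\<close> and \<open>|x|^(-2b)\<close>. A member \<open>(u, Du)\<close> is an element
  \<open>u\<close> of the completion together with its gradient \<open>Du\<close>, the limit of the gradients of
  the approximating test functions; both components are representatives up to null sets.
  Finiteness of the two weighted integrals of \<open>u\<close> and \<open>Du\<close> is implied by the convergence
  whenever the weights are locally integrable, that is, for \<open>2a < N\<close> and \<open>2b < N\<close>.
\<close>
definition X_space :: "real \<Rightarrow> real \<Rightarrow> ((real^'n \<Rightarrow> real) \<times> (real^'n \<Rightarrow> real^'n)) set" where
  "X_space a b = {(u, Du).
     u \<in> borel_measurable lebesgue \<and> Du \<in> borel_measurable lebesgue \<and>
     (\<exists>\<phi>. (\<forall>n. test_function (\<phi> n)) \<and>
        (\<lambda>n. (\<integral>\<^sup>+x. ennreal ((norm (grad (\<phi> n) x - Du x))\<^sup>2 / norm x powr (2 * b)) \<partial>lebesgue)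
           + (\<integral>\<^sup>+x. ennreal (\<bar>\<phi> n x - u x\<bar>\<^sup>2 / norm x powr (2 * a)) \<partial>lebesgue))
        \<longlonglongrightarrow> 0)}"

text \<open>
  For \<open>(u, Du)\<close> in \<open>X_space a b\<close> with \<open>0 \<le> b < (N - 2)/2\<close> and \<open>a \<le> N b/(N - 2)\<close>, the integral
  of \<open>|u|^2 / |x|^s\<close> is finite for every \<open>s\<close> in \<open>[2a, 2b + 2]\<close>, by the weighted Hardy inequality
  at \<open>s = 2b + 2\<close>; so the value 0 of the integral of a non-integrable function never occurs.
\<close>
definition delta1 ::
  "real \<Rightarrow> real \<Rightarrow> (real^'n \<Rightarrow> real) \<Rightarrow> (real^'n \<Rightarrow> real^'n) \<Rightarrow> real" where
  "delta1 a b u Du =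
     sqrt (LINT x|lebesgue. \<bar>u x\<bar>\<^sup>2 / norm x powr (2 * a)) *
     sqrt (LINT x|lebesgue. (norm (Du x))\<^sup>2 / norm x powr (2 * b))
     - \<bar>(real CARD('n) - a - b - 1) / 2\<bar> *
       (LINT x|lebesgue. \<bar>u x\<bar>\<^sup>2 / norm x powr (a + b + 1))"

definition E_set :: "real \<Rightarrow> real \<Rightarrow> (real^'n \<Rightarrow> real) set" where
  "E_set a b = {v. \<exists>\<alpha> \<beta>. \<beta> > 0 \<and>
     v = (\<lambda>x. \<alpha> * exp (- (\<beta> / (b + 1 - a)) * norm x powr (b + 1 - a)))}"

end

(*
  Put s = b + 1 - a > 0 and Phi = exp(-|x|^s / s). Completing the square,

    int |Du|^2/|x|^2b + int u^2/|x|^2a - (N-a-b-1) int u^2/|x|^(a+b+1)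
      = int |Du + u |x|^(b-a-1) x|^2/|x|^2b = int |D(u/Phi)|^2 Phi^2/|x|^2b,

  where the cross term is integrated by parts by differentiating a dilation. The right side does
  not change when a multiple of Phi is subtracted from u. For w = u - c Phi, Hardy's inequality
  bounds h int w^2/|x|^(2b+2) + int w^2/|x|^2a by the deficit plus K int w^2/|x|^(a+b+1). The last
  weight lies strictly between the other two, so it is absorbed outside a ball; inside, choose c by
  the unweighted Poincare inequality for u/Phi, which applies because b >= 0. This is done for
  rapidly decaying functions, a class that contains the test functions and Phi and is stable under
  dilation; a dilation balancing the two energies gives the multiplicative version. Hardy's
  inequality and Fatou's lemma then carry both estimates to the completion.
*)
theory Submission
  imports Defs
begin

section \<open>Integration over R^n and dilations\<close>

text \<open>The deficit sees only the gradient of \<open>U / Phi\<close>, so it vanishes on the line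
  spanned by Phi and a lower bound has to detect a constant. This is not done by a Poincare
  inequality for the density \<open>Phi^2 / |x|^(2b)\<close> on the whole space:
  \<open>a + b + 1\<close> is the midpoint of \<open>2a\<close> and \<open>2b + 2\<close>, so the
  two positive energies beat the negative term far out, and a constant has to be found only on a
  ball. The exponent \<open>2bN/(N - 2)\<close> is used through its position in
  \<open>[2a, 2b + 2)\<close>, which is what the upper bounds on \<open>a\<close> and
  \<open>b\<close> say; this also gives \<open>a < b + 1\<close>. The obstacle is the origin, where
  weights may be singular and Phi need not be differentiable. Dilations fix the origin and leave no
  boundary term there, and almost every segment in the Poincare argument misses it. In the
  completion neither the constants \<open>c\<close> nor the dilation factors are shown to converge.
  Only infima are compared, through \<open>(p + q)^2 \<le> 2 p^2 + 2 q^2\<close>, at the price of a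
  factor 2.\<close>

lemma nn_integral_lborel_affine:
  fixes t :: "'a::euclidean_space"
  assumes "c \<noteq> 0" and [measurable]: "f \<in> borel_measurable borel"
  shows "integral\<^sup>N lborel f = ennreal (\<bar>c\<bar> ^ DIM('a)) * (\<integral>\<^sup>+x. f (t + c *\<^sub>R x) \<partial>lborel)"
  by (subst lborel_affine[OF assms(1), of t])
    (simp add: nn_integral_density nn_integral_distr nn_integral_cmult)

lemma integral_lborel_scaleR:
  fixes f :: "'a::euclidean_space \<Rightarrow> real"
  assumes "c > 0" and [measurable]: "f \<in> borel_measurable borel"
  shows "integral\<^sup>L lborel f = c ^ DIM('a) * (\<integral>x. f (c *\<^sub>R x) \<partial>lborel)"
proof -
  have "c \<noteq> 0" using assms by simp
  show ?thesis
    by (subst lborel_affine[OF \<open>c \<noteq> 0\<close>, of 0])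
      (use assms(1) in \<open>simp add: integral_density integral_distr\<close>)
qed

lemma integral_scaleR_powr:
  fixes f :: "'a::euclidean_space \<Rightarrow> real"
  assumes c: "c > 0" and [measurable]: "f \<in> borel_measurable borel"
  shows "(LINT x|lborel. f (c *\<^sub>R x) / norm x powr p)
    = c powr (p - DIM('a)) * (LINT x|lborel. f x / norm x powr p)"
proof -
  let ?I = "LINT x|lborel. f x / norm x powr p"
  have eq: "c powr p * (f (c *\<^sub>R x) / norm (c *\<^sub>R x) powr p) = f (c *\<^sub>R x) / norm x powr p" for x
    using c by (simp add: powr_mult)
  have "?I = c ^ DIM('a) * (LINT x|lborel. f (c *\<^sub>R x) / norm (c *\<^sub>R x) powr p)"
    by (rule integral_lborel_scaleR) (use c in auto)
  then have "c powr p * ?I = c ^ DIM('a) * (LINT x|lborel. c powr p * (f (c *\<^sub>R x) / norm (c *\<^sub>R x) powr p))"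
    by (simp only: integral_mult_right_zero mult.left_commute[of "c powr p"])
  then have "c powr p * ?I = c powr DIM('a) * (LINT x|lborel. f (c *\<^sub>R x) / norm x powr p)"
    unfolding eq using c by (simp add: powr_realpow)
  then show ?thesis
    using c by (simp add: powr_diff field_simps)
qed

section \<open>Integrability of power weights\<close>

text \<open>The indicators of the balls of radius \<open>\<rho> k\<close>, weighted by
  \<open>c k\<close>, add up to a majorant of \<open>f\<close>. Balls in place of shells let one
  lemma serve both radii shrinking to 0 and radii growing to infinity.\<close>

lemma nn_integral_dyadic_finite:
  fixes f :: "'a::euclidean_space \<Rightarrow> real"
  assumes k: "\<And>x. f x \<noteq> 0 \<Longrightarrow> \<exists>k. norm x \<le> \<rho> k \<and> f x \<le> c k"
    and pos: "\<And>k. 0 \<le> \<rho> k" "\<And>k. 0 \<le> c k"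
    and s: "summable (\<lambda>k::nat. c k * \<rho> k ^ DIM('a))"
  shows "(\<integral>\<^sup>+x. ennreal (f x) \<partial>lborel) < \<infinity>"
proof -
  have "(\<integral>\<^sup>+x. ennreal (f x) \<partial>lborel)
      \<le> (\<integral>\<^sup>+x. (\<Sum>k. ennreal (c k) * indicator (cball (0::'a) (\<rho> k)) x) \<partial>lborel)"
  proof (rule nn_integral_mono)
    fix x :: 'a
    show "ennreal (f x) \<le> (\<Sum>k. ennreal (c k) * indicator (cball 0 (\<rho> k)) x)"
    proof (cases "f x = 0")
      case False
      then obtain k where "norm x \<le> \<rho> k" "f x \<le> c k" using k by blast
      then have "ennreal (f x) \<le> (\<Sum>j\<in>{k}. ennreal (c j) * indicator (cball 0 (\<rho> j)) x)"
        by (simp add: ennreal_leI)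
      also have "\<dots> \<le> (\<Sum>j. ennreal (c j) * indicator (cball 0 (\<rho> j)) x)"
        by (rule sum_le_suminf) auto
      finally show ?thesis .
    qed simp
  qed
  also have "\<dots> = (\<Sum>k. ennreal (c k) * emeasure lborel (cball (0::'a) (\<rho> k)))"
    by (subst nn_integral_suminf)
      (auto simp: nn_integral_cmult_indicator intro!: borel_measurable_times_ennreal borel_measurable_indicator)
  also have "\<dots> = (\<Sum>k. ennreal (unit_ball_vol DIM('a) * (c k * \<rho> k ^ DIM('a))))"
    using pos by (simp add: emeasure_cball ennreal_mult'[symmetric] mult_ac)
  also have "\<dots> < \<infinity>"
    using s pos by (subst suminf_ennreal2) (auto intro!: summable_mult mult_nonneg_nonneg)
  finally show ?thesis .
qed

text \<open>The first condition on \<open>p\<close> gives integrability at the origin, the second at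
  infinity. The unit sphere separates the two regimes, and on each side a pure power is summed over
  dyadic shells.\<close>

lemma integrable_powr_decay:
  assumes p: "p < real DIM('a)" "real DIM('a) < p + real m"
  shows "integrable lborel (\<lambda>x::'a::euclidean_space. 1 / (norm x powr p * (1 + norm x) ^ m))"
proof -
  let ?f = "\<lambda>x::'a. 1 / (norm x powr p * (1 + norm x) ^ m)"
  define f1 :: "'a \<Rightarrow> real" where "f1 x = (if x \<noteq> 0 \<and> norm x \<le> 1 then norm x powr (- p) else 0)" for x
  define f2 :: "'a \<Rightarrow> real" where "f2 x = (if norm x > 1 then norm x powr (- (p + m)) else 0)" for x
  have [measurable]: "f1 \<in> borel_measurable borel" "f2 \<in> borel_measurable borel"
    unfolding f1_def f2_def by measurable
  \<comment> \<open>On the shell \<open>norm x = 2 powr (- t)\<close> with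
    \<open>k \<le> t \<le> k + 1\<close> the value is \<open>2 powr (t * p)\<close>; the slack
    \<open>\<bar>p\<bar>\<close> in the exponent covers both signs of \<open>p\<close>.\<close>
  have f1: "(\<integral>\<^sup>+x. ennreal (f1 x) \<partial>lborel) < \<infinity>"
  proof (rule nn_integral_dyadic_finite[where \<rho> = "\<lambda>k. 2 powr (- real k)"
        and c = "\<lambda>k. 2 powr (real k * p + \<bar>p\<bar>)"])
    fix x :: 'a assume "f1 x \<noteq> 0"
    then have x: "x \<noteq> 0" "norm x \<le> 1" "f1 x = norm x powr (- p)" by (auto simp: f1_def split: if_splits)
    define t where "t = - log 2 (norm x)"
    have t: "norm x = 2 powr (- t)" "t \<ge> 0"
      using x by (auto simp: t_def zero_le_log_cancel_iff)
    define k where "k = nat \<lfloor>t\<rfloor>"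
    have k: "real k \<le> t" "t \<le> real k + 1" using t by (auto simp: k_def)
    have "norm x \<le> 2 powr (- real k)" using t k by simp
    moreover have "t * p \<le> real k * p + \<bar>p\<bar>"
    proof -
      have "\<bar>(t - real k) * p\<bar> \<le> 1 * \<bar>p\<bar>"
        unfolding abs_mult by (rule mult_right_mono) (use k in auto)
      then show ?thesis by (simp add: algebra_simps)
    qed
    then have "f1 x \<le> 2 powr (real k * p + \<bar>p\<bar>)" using x t by (simp add: powr_powr)
    ultimately show "\<exists>k. norm x \<le> 2 powr (- real k) \<and> f1 x \<le> 2 powr (real k * p + \<bar>p\<bar>)" by blast
  next
    have "(2::real) powr (p - real DIM('a)) < 2 powr 0" using p by (subst powr_less_cancel_iff) auto
    then have "summable (\<lambda>k. 2 powr \<bar>p\<bar> * (2 powr (p - real DIM('a))) ^ k)"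
      by (intro summable_mult summable_geometric) auto
    also have "(\<lambda>k. 2 powr \<bar>p\<bar> * (2 powr (p - real DIM('a))) ^ k) =
        (\<lambda>k. 2 powr (real k * p + \<bar>p\<bar>) * (2 powr - real k) ^ DIM('a))"
      by (auto simp: fun_eq_iff powr_realpow[symmetric] powr_powr powr_add[symmetric] algebra_simps)
    finally show "summable (\<lambda>k. 2 powr (real k * p + \<bar>p\<bar>) * (2 powr - real k) ^ DIM('a))" .
  qed auto
  \<comment> \<open>Here \<open>p + m > 0\<close>, so the function decreases in
    \<open>norm x\<close>: the ball takes the outer radius of the shell and the bound its value at
    the inner radius.\<close>
  have f2: "(\<integral>\<^sup>+x. ennreal (f2 x) \<partial>lborel) < \<infinity>"
  proof (rule nn_integral_dyadic_finite[where \<rho> = "\<lambda>k. 2 powr (real k + 1)"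
        and c = "\<lambda>k. 2 powr (- (real k * (p + m)))"])
    fix x :: 'a assume "f2 x \<noteq> 0"
    then have x: "norm x > 1" "f2 x = norm x powr (- (p + m))" by (auto simp: f2_def split: if_splits)
    define t where "t = log 2 (norm x)"
    have "0 < norm x" using x(1) by linarith
    then have t: "norm x = 2 powr t" "t \<ge> 0"
      using x by (auto simp: t_def)
    define k where "k = nat \<lfloor>t\<rfloor>"
    have k: "real k \<le> t" "t \<le> real k + 1" using t by (auto simp: k_def)
    have "norm x \<le> 2 powr (real k + 1)" using t k by simp
    moreover have "real k * (p + m) \<le> t * (p + m)" using p k by (intro mult_right_mono) auto
    then have "f2 x \<le> 2 powr (- (real k * (p + m)))" using x t by (simp add: powr_powr algebra_simps)
    ultimately show "\<exists>k. norm x \<le> 2 powr (real k + 1) \<and> f2 x \<le> 2 powr (- (real k * (p + m)))" by blast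
  next
    have "(2::real) powr (real DIM('a) - (p + m)) < 2 powr 0" using p by (subst powr_less_cancel_iff) auto
    then have "summable (\<lambda>k. 2 powr DIM('a) * (2 powr (real DIM('a) - (p + m))) ^ k)"
      by (intro summable_mult summable_geometric) auto
    also have "(\<lambda>k. 2 powr DIM('a) * (2 powr (real DIM('a) - (p + m))) ^ k) =
        (\<lambda>k. 2 powr (- (real k * (p + m))) * (2 powr (real k + 1)) ^ DIM('a))"
      by (auto simp: fun_eq_iff powr_realpow[symmetric] powr_powr powr_add[symmetric] algebra_simps)
    finally show "summable (\<lambda>k. 2 powr (- (real k * (p + m))) * (2 powr (real k + 1)) ^ DIM('a))" .
  qed auto
  have le: "?f x \<le> f1 x + f2 x" for x
  proof (cases "x = 0")
    case False
    have pw: "norm x powr (- q) = 1 / norm x powr q" for q by (simp add: powr_minus_divide)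
    show ?thesis
    proof (cases "norm x \<le> 1")
      case True
      have "1 \<le> (1 + norm x) ^ m" by (simp add: one_le_power)
      then have "norm x powr p * 1 \<le> norm x powr p * (1 + norm x) ^ m" by (intro mult_left_mono) auto
      then have "?f x \<le> norm x powr (- p)"
        using False unfolding pw by (intro divide_left_mono mult_pos_pos zero_less_power add_pos_nonneg) auto
      then show ?thesis using True False by (simp add: f1_def f2_def)
    next
      case nle: False
      have "norm x powr (p + m) = norm x powr p * norm x ^ m"
        using False by (simp add: powr_add powr_realpow)
      also have "\<dots> \<le> norm x powr p * (1 + norm x) ^ m"
        by (intro mult_left_mono power_mono) auto
      finally have "?f x \<le> norm x powr (- (p + m))" using False unfolding pw by (intro divide_left_mono mult_pos_pos zero_less_power add_pos_nonneg) auto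
      then show ?thesis using nle by (simp add: f1_def f2_def)
    qed
  qed (simp add: f1_def f2_def)
  have "(\<integral>\<^sup>+x. ennreal (norm (?f x)) \<partial>lborel) \<le> (\<integral>\<^sup>+x. ennreal (f1 x) + ennreal (f2 x) \<partial>lborel)"
  proof (rule nn_integral_mono)
    fix x
    have "norm (?f x) = ?f x" by (simp add: abs_mult)
    also have "ennreal (?f x) \<le> ennreal (f1 x + f2 x)" by (rule ennreal_leI[OF le])
    finally show "ennreal (norm (?f x)) \<le> ennreal (f1 x) + ennreal (f2 x)"
      by (simp add: f1_def f2_def split: if_splits)
  qed
  also have "\<dots> < \<infinity>" using f1 f2 by (subst nn_integral_add) auto
  finally show ?thesis by (intro integrableI_bounded) auto
qed

text \<open>Integration by parts: differentiate the integral of \<open>f (\<lambda> x) / |x|^p\<close>, which is a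
  power of \<open>\<lambda>\<close> times a constant, at \<open>\<lambda> = 1\<close>.\<close>

lemma integral_radial_derivative:
  fixes f :: "'a::euclidean_space \<Rightarrow> real"
  assumes [measurable]: "f \<in> borel_measurable borel" "g \<in> borel_measurable borel"
    and deriv: "\<And>x. x \<noteq> 0 \<Longrightarrow> (f has_derivative f' x) (at x)"
    and g: "\<And>x. x \<noteq> 0 \<Longrightarrow> g x = f' x x"
    and bound: "\<And>x. x \<noteq> 0 \<Longrightarrow> \<bar>f x\<bar> * (1 + norm x) ^ m \<le> C" "\<And>x. x \<noteq> 0 \<Longrightarrow> \<bar>g x\<bar> * (1 + norm x) ^ m \<le> C"
    and p: "p < real DIM('a)" "real DIM('a) < p + real m"
  shows "(LINT x|lborel. g x / norm x powr p) = (p - DIM('a)) * (LINT x|lborel. f x / norm x powr p)"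
proof -
  let ?w = "\<lambda>x::'a. C * (1 / (norm x powr p * (1 + norm x) ^ m))"
  have w: "integrable lborel ?w"
    using integrable_powr_decay[OF p] by (rule integrable_mult_right)
  have AE0: "AE x::'a in lborel. x \<noteq> 0" by (rule AE_lborel_singleton)
  have le_w: "\<bar>y / norm x powr p\<bar> \<le> ?w x" if "x \<noteq> 0" "\<bar>y\<bar> * (1 + norm x) ^ m \<le> C" for y and x :: 'a
  proof -
    have "\<bar>y\<bar> \<le> C / (1 + norm x) ^ m"
      using that by (subst pos_le_divide_eq) (auto intro!: zero_less_power add_pos_nonneg)
    then have "\<bar>y\<bar> / norm x powr p \<le> C / (1 + norm x) ^ m / norm x powr p"
      by (rule divide_right_mono) auto
    then show ?thesis by (simp add: abs_mult mult_ac)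
  qed
  have integrableI: "integrable lborel h"
    if [measurable]: "h \<in> borel_measurable borel" and h: "\<And>x. x \<noteq> 0 \<Longrightarrow> \<bar>h x\<bar> \<le> ?w x" for h
  proof (rule Bochner_Integration.integrable_bound[OF w])
    show "AE x in lborel. norm (h x) \<le> norm (?w x)"
      using AE0
    proof (rule eventually_mono)
      fix x :: 'a assume "x \<noteq> 0"
      from order_trans[OF h[OF this] abs_ge_self] show "norm (h x) \<le> norm (?w x)"
        unfolding real_norm_def .
    qed
  qed simp
  have intf: "integrable lborel (\<lambda>x. f x / norm x powr p)"
  proof (rule integrableI)
    show "\<bar>f x / norm x powr p\<bar> \<le> ?w x" if "x \<noteq> 0" for x
      by (rule le_w[OF that bound(1)[OF that]])
  qed simp
  let ?I = "LINT x|lborel. f x / norm x powr p"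
  \<comment> \<open>Factors above 1 move points outwards, so the decay at the dilated point implies
    the same decay at \<open>x\<close>, and one majorant \<open>?w\<close> serves every
    \<open>n\<close>.\<close>
  define l where "l n = 1 + inverse (real (Suc n))" for n
  have l: "l n > 1" for n by (simp add: l_def)
  have l0: "l \<longlonglongrightarrow> 1" unfolding l_def by (rule LIMSEQ_inverse_real_of_nat_add)
  have scaled: "integrable lborel (\<lambda>x. f (c *\<^sub>R x) / norm x powr p)"
    "(LINT x|lborel. f (c *\<^sub>R x) / norm x powr p) = c powr (p - DIM('a)) * ?I" if "c > 1" for c
  proof -
    have c: "c > 0" "c \<noteq> 0" using that by auto
    have "\<bar>f (c *\<^sub>R x) / norm x powr p\<bar> \<le> ?w x" if "x \<noteq> 0" for x
    proof (rule le_w[OF that])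
      have "norm x \<le> norm (c *\<^sub>R x)"
        using \<open>c > 1\<close> mult_right_mono[of 1 c "norm x"] by simp
      then have "\<bar>f (c *\<^sub>R x)\<bar> * (1 + norm x) ^ m \<le> \<bar>f (c *\<^sub>R x)\<bar> * (1 + norm (c *\<^sub>R x)) ^ m"
        by (intro mult_left_mono power_mono) auto
      also have "\<dots> \<le> C" by (rule bound) (use c that in auto)
      finally show "\<bar>f (c *\<^sub>R x)\<bar> * (1 + norm x) ^ m \<le> C" .
    qed
    then show "integrable lborel (\<lambda>x. f (c *\<^sub>R x) / norm x powr p)"
      by (intro integrableI) auto
    show "(LINT x|lborel. f (c *\<^sub>R x) / norm x powr p) = c powr (p - DIM('a)) * ?I"
      by (rule integral_scaleR_powr) (use c in auto)
  qed
  have radial: "((\<lambda>t. f (t *\<^sub>R x)) has_real_derivative g (t *\<^sub>R x) / t) (at t)" if "x \<noteq> 0" "t > 0" for x t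
  proof -
    have *: "(f has_derivative f' (t *\<^sub>R x)) (at (t *\<^sub>R x))" using that by (intro deriv) auto
    interpret L: bounded_linear "f' (t *\<^sub>R x)" using * by (rule has_derivative_bounded_linear)
    have "((\<lambda>t. f (t *\<^sub>R x)) has_derivative (\<lambda>h. f' (t *\<^sub>R x) (h *\<^sub>R x))) (at t)"
      by (rule has_derivative_compose[where f = "\<lambda>t. t *\<^sub>R x" and g = f, OF _ *]) (auto intro!: derivative_eq_intros)
    moreover have "(\<lambda>h. f' (t *\<^sub>R x) (h *\<^sub>R x)) = (*) (g (t *\<^sub>R x) / t)"
      using that by (auto simp: g L.scaleR)
    ultimately show ?thesis unfolding has_field_derivative_def by (simp only:)
  qed
  let ?F = "\<lambda>n x. (f (l n *\<^sub>R x) - f x) / (l n - 1) / norm x powr p"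
  have lim: "(\<lambda>n. LINT x|lborel. ?F n x) \<longlonglongrightarrow> (LINT x|lborel. g x / norm x powr p)"
  proof (rule integral_dominated_convergence[OF _ _ w])
    show "AE x in lborel. (\<lambda>n. ?F n x) \<longlonglongrightarrow> g x / norm x powr p"
      using AE0
    proof (rule eventually_mono)
      fix x :: 'a assume x: "x \<noteq> 0"
      have "((\<lambda>t. (f (t *\<^sub>R x) - f (1 *\<^sub>R x)) / (t - 1)) \<longlongrightarrow> g (1 *\<^sub>R x) / 1) (at 1)"
        using radial[OF x, of 1] unfolding has_field_derivative_iff by simp
      then have "(\<lambda>n. (f (l n *\<^sub>R x) - f (1 *\<^sub>R x)) / (l n - 1)) \<longlonglongrightarrow> g (1 *\<^sub>R x) / 1"
        by (rule filterlim_compose)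
          (use l0 l in \<open>auto simp: filterlim_at intro!: always_eventually simp: less_imp_neq[symmetric]\<close>)
      then show "(\<lambda>n. ?F n x) \<longlonglongrightarrow> g x / norm x powr p"
        by (intro tendsto_divide) (use x in auto)
    qed
    show "AE x in lborel. norm (?F n x) \<le> ?w x" for n
      using AE0
    proof (rule eventually_mono)
      fix x :: 'a assume x: "x \<noteq> 0"
      \<comment> \<open>The mean value theorem in the dilation factor turns the quotient into a
        value of \<open>g\<close> farther out on the same ray, where \<open>bound\<close>
        applies.\<close>
      obtain z where z: "1 < z" "z < l n" "f (l n *\<^sub>R x) - f (1 *\<^sub>R x) = (l n - 1) * (g (z *\<^sub>R x) / z)"
        using MVT2[OF l[of n], of "\<lambda>t. f (t *\<^sub>R x)" "\<lambda>t. g (t *\<^sub>R x) / t"] radial[OF x] by auto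
      have "\<bar>(f (l n *\<^sub>R x) - f x) / (l n - 1) / norm x powr p\<bar> \<le> ?w x"
      proof (rule le_w[OF x])
        have "\<bar>(f (l n *\<^sub>R x) - f x) / (l n - 1)\<bar> = \<bar>g (z *\<^sub>R x)\<bar> / z" using z l[of n] by simp
        also have "\<dots> \<le> \<bar>g (z *\<^sub>R x)\<bar>" using z divide_left_mono[of 1 z "\<bar>g (z *\<^sub>R x)\<bar>"] by simp
        finally have "\<bar>(f (l n *\<^sub>R x) - f x) / (l n - 1)\<bar> \<le> \<bar>g (z *\<^sub>R x)\<bar>" .
        moreover have "norm x \<le> norm (z *\<^sub>R x)"
          using z mult_right_mono[of 1 z "norm x"] by simp
        ultimately have "\<bar>(f (l n *\<^sub>R x) - f x) / (l n - 1)\<bar> * (1 + norm x) ^ m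
            \<le> \<bar>g (z *\<^sub>R x)\<bar> * (1 + norm (z *\<^sub>R x)) ^ m"
          by (intro mult_mono power_mono) simp_all
        also have "\<dots> \<le> C" by (rule bound) (use z x in auto)
        finally show "\<bar>(f (l n *\<^sub>R x) - f x) / (l n - 1)\<bar> * (1 + norm x) ^ m \<le> C" .
      qed
      then show "norm (?F n x) \<le> ?w x" by simp
    qed
  qed auto
  have "(LINT x|lborel. ?F n x) = (l n powr (p - DIM('a)) - 1) / (l n - 1) * ?I" for n
  proof -
    have "(LINT x|lborel. ?F n x) = (LINT x|lborel. (f (l n *\<^sub>R x) / norm x powr p - f x / norm x powr p) / (l n - 1))"
      by (intro Bochner_Integration.integral_cong) (auto simp: diff_divide_distrib mult_ac)
    also have "\<dots> = (l n powr (p - DIM('a)) * ?I - ?I) / (l n - 1)"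
      using scaled[OF l[of n]] intf by simp
    finally show ?thesis by (simp add: algebra_simps diff_divide_distrib)
  qed
  \<comment> \<open>The factor in front of \<open>?I\<close> is the difference quotient of
    \<open>t powr (p - DIM('a))\<close> at 1, whence the constant
    \<open>p - DIM('a)\<close>.\<close>
  moreover have "(\<lambda>n. (l n powr (p - DIM('a)) - 1) / (l n - 1) * ?I) \<longlonglongrightarrow> (p - DIM('a)) * ?I"
  proof (rule tendsto_mult_right)
    have "((\<lambda>t. t powr (p - DIM('a))) has_real_derivative (p - DIM('a)) * 1 powr (p - DIM('a) - 1)) (at 1)"
      by (rule has_real_derivative_powr) auto
    then have "((\<lambda>t. (t powr (p - DIM('a)) - 1 powr (p - DIM('a))) / (t - 1)) \<longlongrightarrow> (p - DIM('a)) * 1) (at 1)"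
      unfolding has_field_derivative_iff by simp
    then have "(\<lambda>n. (l n powr (p - DIM('a)) - 1 powr (p - DIM('a))) / (l n - 1)) \<longlonglongrightarrow> (p - DIM('a)) * 1"
      by (rule filterlim_compose)
        (use l0 l in \<open>auto simp: filterlim_at intro!: always_eventually simp: less_imp_neq[symmetric]\<close>)
    then show "(\<lambda>n. (l n powr (p - DIM('a)) - 1) / (l n - 1)) \<longlonglongrightarrow> p - DIM('a)" by simp
  qed
  ultimately show ?thesis using lim by (auto intro: LIMSEQ_unique)
qed

section \<open>Functions of rapid decay\<close>

text \<open>Nothing is required at the origin, where \<open>\<Phi>\<close> need not be differentiable.\<close>

definition rapid :: "('a::euclidean_space \<Rightarrow> real) \<Rightarrow> ('a \<Rightarrow> 'a) \<Rightarrow> bool" where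
  "rapid U V \<longleftrightarrow> continuous_on (- {0}) V \<and>
     (\<forall>x. x \<noteq> 0 \<longrightarrow> (U has_derivative (\<lambda>h. V x \<bullet> h)) (at x)) \<and>
     (\<forall>m::nat. \<exists>C. \<forall>x. x \<noteq> 0 \<longrightarrow>
        \<bar>U x\<bar> * (1 + norm x) ^ m \<le> C \<and> norm x * norm (V x) * (1 + norm x) ^ m \<le> C)"

lemma borel_measurable_continuous_off_0:
  fixes f :: "'a::euclidean_space \<Rightarrow> 'b::topological_space"
  assumes "continuous_on (- {0}) f"
  shows "f \<in> borel_measurable borel"
proof -
  have "(\<lambda>x. if x \<in> - {0} then f x else f 0) \<in> borel_measurable borel"
    by (rule borel_measurable_continuous_on_if) (use assms in auto)
  moreover have "(\<lambda>x. if x \<in> - {0} then f x else f 0) = f" by auto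
  ultimately show ?thesis by simp
qed

lemma rapid_derivative: "rapid U V \<Longrightarrow> x \<noteq> 0 \<Longrightarrow> (U has_derivative (\<lambda>h. V x \<bullet> h)) (at x)"
  by (simp add: rapid_def)

lemma rapid_continuous:
  assumes "rapid U V"
  shows "continuous_on (- {0}) U" "continuous_on (- {0}) V"
  using assms
  by (auto simp: rapid_def intro!: continuous_at_imp_continuous_on has_derivative_continuous)

lemma rapid_measurable:
  assumes "rapid U V"
  shows "U \<in> borel_measurable borel" "V \<in> borel_measurable borel"
  using rapid_continuous[OF assms] by (auto intro!: borel_measurable_continuous_off_0)

lemma rapid_bound:
  assumes "rapid U V"
  obtains C where "0 \<le> C" "\<And>x. x \<noteq> 0 \<Longrightarrow> \<bar>U x\<bar> * (1 + norm x) ^ m \<le> C"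
    "\<And>x. x \<noteq> 0 \<Longrightarrow> norm x * norm (V x) * (1 + norm x) ^ m \<le> C"
proof -
  obtain C where C: "\<forall>x. x \<noteq> 0 \<longrightarrow> \<bar>U x\<bar> * (1 + norm x) ^ m \<le> C \<and> norm x * norm (V x) * (1 + norm x) ^ m \<le> C"
    using assms unfolding rapid_def by metis
  \<comment> \<open>A basis vector is a nonzero point at which the bound can be read, and this
    forces \<open>0 \<le> C\<close>.\<close>
  obtain b :: 'a where "b \<in> Basis" using nonempty_Basis by blast
  then have "0 \<le> \<bar>U b\<bar> * (1 + norm b) ^ m" "b \<noteq> 0" by auto
  then have "0 \<le> C" using C order_trans by blast
  then show thesis using that C by blast
qed

lemma rapidI:
  assumes "continuous_on (- {0}) V"
    and "\<And>x. x \<noteq> 0 \<Longrightarrow> (U has_derivative (\<lambda>h. V x \<bullet> h)) (at x)"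
    and "\<And>m::nat. \<exists>C. \<forall>x. x \<noteq> 0 \<longrightarrow>
        \<bar>U x\<bar> * (1 + norm x) ^ m \<le> C \<and> norm x * norm (V x) * (1 + norm x) ^ m \<le> C"
  shows "rapid U V"
  using assms by (simp add: rapid_def)

lemma rapid_lincomb:
  assumes U: "rapid U V" and U': "rapid U' V'"
  shows "rapid (\<lambda>x. U x - c * U' x) (\<lambda>x. V x - c *\<^sub>R V' x)"
proof (rule rapidI)
  show "continuous_on (- {0}) (\<lambda>x. V x - c *\<^sub>R V' x)"
    using rapid_continuous[OF U] rapid_continuous[OF U'] by (intro continuous_intros)
  show "((\<lambda>x. U x - c * U' x) has_derivative (\<lambda>h. (V x - c *\<^sub>R V' x) \<bullet> h)) (at x)" if "x \<noteq> 0" for x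
    by (auto intro!: derivative_eq_intros rapid_derivative[OF U that] rapid_derivative[OF U' that]
        simp: inner_diff_left)
  fix m
  obtain C where C: "\<And>x. x \<noteq> 0 \<Longrightarrow> \<bar>U x\<bar> * (1 + norm x) ^ m \<le> C"
    "\<And>x. x \<noteq> 0 \<Longrightarrow> norm x * norm (V x) * (1 + norm x) ^ m \<le> C" by (rule rapid_bound[OF U]) blast
  obtain D where D: "\<And>x. x \<noteq> 0 \<Longrightarrow> \<bar>U' x\<bar> * (1 + norm x) ^ m \<le> D"
    "\<And>x. x \<noteq> 0 \<Longrightarrow> norm x * norm (V' x) * (1 + norm x) ^ m \<le> D" by (rule rapid_bound[OF U']) blast
  show "\<exists>C. \<forall>x. x \<noteq> 0 \<longrightarrow> \<bar>U x - c * U' x\<bar> * (1 + norm x) ^ m \<le> C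
      \<and> norm x * norm (V x - c *\<^sub>R V' x) * (1 + norm x) ^ m \<le> C"
  proof (intro exI allI impI conjI)
    fix x :: 'a assume x: "x \<noteq> 0"
    have "\<bar>U x - c * U' x\<bar> \<le> \<bar>U x\<bar> + \<bar>c\<bar> * \<bar>U' x\<bar>"
      by (metis abs_mult abs_triangle_ineq4)
    then have "\<bar>U x - c * U' x\<bar> * (1 + norm x) ^ m \<le> (\<bar>U x\<bar> + \<bar>c\<bar> * \<bar>U' x\<bar>) * (1 + norm x) ^ m"
      by (rule mult_right_mono) simp
    also have "\<dots> = \<bar>U x\<bar> * (1 + norm x) ^ m + \<bar>c\<bar> * (\<bar>U' x\<bar> * (1 + norm x) ^ m)"
      by (simp add: algebra_simps)
    also have "\<dots> \<le> C + \<bar>c\<bar> * D"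
      by (intro add_mono mult_left_mono C D x) simp
    finally show "\<bar>U x - c * U' x\<bar> * (1 + norm x) ^ m \<le> C + \<bar>c\<bar> * D" .
    have "norm (V x - c *\<^sub>R V' x) \<le> norm (V x) + \<bar>c\<bar> * norm (V' x)"
      by (metis norm_scaleR norm_triangle_ineq4)
    then have "norm x * norm (V x - c *\<^sub>R V' x) * (1 + norm x) ^ m
        \<le> norm x * (norm (V x) + \<bar>c\<bar> * norm (V' x)) * (1 + norm x) ^ m"
      by (intro mult_right_mono mult_left_mono) simp_all
    also have "\<dots> = norm x * norm (V x) * (1 + norm x) ^ m + \<bar>c\<bar> * (norm x * norm (V' x) * (1 + norm x) ^ m)"
      by (simp add: algebra_simps)
    also have "\<dots> \<le> C + \<bar>c\<bar> * D"
      by (intro add_mono mult_left_mono C D x) simp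
    finally show "norm x * norm (V x - c *\<^sub>R V' x) * (1 + norm x) ^ m \<le> C + \<bar>c\<bar> * D" .
  qed
qed

lemma rapid_scaleR:
  assumes U: "rapid U V" and c: "c > 0"
  shows "rapid (\<lambda>x. U (c *\<^sub>R x)) (\<lambda>x. c *\<^sub>R V (c *\<^sub>R x))"
proof (rule rapidI)
  show "continuous_on (- {0}) (\<lambda>x. c *\<^sub>R V (c *\<^sub>R x))"
    using rapid_continuous(2)[OF U] c
    by (intro continuous_intros continuous_on_compose2[OF rapid_continuous(2)[OF U]]) auto
  show "((\<lambda>x. U (c *\<^sub>R x)) has_derivative (\<lambda>h. (c *\<^sub>R V (c *\<^sub>R x)) \<bullet> h)) (at x)" if "x \<noteq> 0" for x
  proof -
    have "((\<lambda>x. U (c *\<^sub>R x)) has_derivative (\<lambda>h. V (c *\<^sub>R x) \<bullet> (c *\<^sub>R h))) (at x)"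
      by (rule has_derivative_compose[OF _ rapid_derivative[OF U]])
        (use that c in \<open>auto intro!: derivative_eq_intros\<close>)
    then show ?thesis by simp
  qed
  fix m
  obtain C where C: "0 \<le> C" "\<And>x. x \<noteq> 0 \<Longrightarrow> \<bar>U x\<bar> * (1 + norm x) ^ m \<le> C"
    "\<And>x. x \<noteq> 0 \<Longrightarrow> norm x * norm (V x) * (1 + norm x) ^ m \<le> C" by (rule rapid_bound[OF U]) blast
  show "\<exists>C. \<forall>x. x \<noteq> 0 \<longrightarrow> \<bar>U (c *\<^sub>R x)\<bar> * (1 + norm x) ^ m \<le> C
      \<and> norm x * norm (c *\<^sub>R V (c *\<^sub>R x)) * (1 + norm x) ^ m \<le> C"
  proof (intro exI allI impI conjI)
    fix x :: 'a assume x: "x \<noteq> 0"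
    let ?y = "c *\<^sub>R x"
    have y: "?y \<noteq> 0" using x c by simp
    have "1 + norm x \<le> (1 + 1 / c) * (1 + norm ?y)"
      using c by (simp add: field_simps)
    then have le: "(1 + norm x) ^ m \<le> (1 + 1 / c) ^ m * (1 + norm ?y) ^ m"
      unfolding power_mult_distrib[symmetric] by (intro power_mono) auto
    have "\<bar>U ?y\<bar> * (1 + norm x) ^ m \<le> (1 + 1 / c) ^ m * (\<bar>U ?y\<bar> * (1 + norm ?y) ^ m)"
      using mult_left_mono[OF le, of "\<bar>U ?y\<bar>"] by (simp add: mult_ac)
    also have "\<dots> \<le> (1 + 1 / c) ^ m * C"
      by (intro mult_left_mono C y) (use c in auto)
    finally show "\<bar>U ?y\<bar> * (1 + norm x) ^ m \<le> (1 + 1 / c) ^ m * C" .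
    have "norm x * norm (c *\<^sub>R V ?y) * (1 + norm x) ^ m
        \<le> (1 + 1 / c) ^ m * (norm ?y * norm (V ?y) * (1 + norm ?y) ^ m)"
      using mult_left_mono[OF le, of "norm ?y * norm (V ?y)"] c by (simp add: mult_ac)
    also have "\<dots> \<le> (1 + 1 / c) ^ m * C"
      by (intro mult_left_mono C y) (use c in auto)
    finally show "norm x * norm (c *\<^sub>R V ?y) * (1 + norm x) ^ m \<le> (1 + 1 / c) ^ m * C" .
  qed
qed

section \<open>Weighted integrals, integration by parts and Hardy's inequality for rapidly decaying
  functions\<close>

lemma rapid_integrable:
  fixes h :: "'a::euclidean_space \<Rightarrow> real"
  assumes [measurable]: "h \<in> borel_measurable borel"
    and h: "\<And>m::nat. \<exists>C. \<forall>x. x \<noteq> 0 \<longrightarrow> \<bar>h x\<bar> * (1 + norm x) ^ m \<le> C"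
    and p: "p < real DIM('a)"
  shows "integrable lborel (\<lambda>x. h x / norm x powr p)"
proof -
  define m where "m = nat \<lceil>real DIM('a) - p\<rceil> + 1"
  have m: "real DIM('a) < p + real m" unfolding m_def using p by (simp add: of_nat_nat) linarith
  obtain C where C: "\<And>x. x \<noteq> 0 \<Longrightarrow> \<bar>h x\<bar> * (1 + norm x) ^ m \<le> C" using h by blast
  have w: "integrable lborel (\<lambda>x::'a. C * (1 / (norm x powr p * (1 + norm x) ^ m)))"
    using integrable_powr_decay[OF p m] by (rule integrable_mult_right)
  show ?thesis
  proof (rule Bochner_Integration.integrable_bound[OF w])
    show "AE x in lborel. norm (h x / norm x powr p) \<le> norm (C * (1 / (norm x powr p * (1 + norm x) ^ m)))"
      using AE_lborel_singleton[of "0::'a"]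
    proof (rule eventually_mono)
      fix x :: 'a assume x: "x \<noteq> 0"
      have "\<bar>h x\<bar> \<le> C / (1 + norm x) ^ m"
        using C[OF x] by (subst pos_le_divide_eq) (auto intro!: zero_less_power add_pos_nonneg)
      then have "\<bar>h x\<bar> / norm x powr p \<le> C / (1 + norm x) ^ m / norm x powr p"
        by (rule divide_right_mono) auto
      then have "norm (h x / norm x powr p) \<le> C * (1 / (norm x powr p * (1 + norm x) ^ m))"
        by (simp add: mult_ac)
      then show "norm (h x / norm x powr p) \<le> norm (C * (1 / (norm x powr p * (1 + norm x) ^ m)))"
        by (rule order_trans) (simp only: real_norm_def abs_ge_self)
    qed
  qed simp
qed

text \<open>One factor supplies all the decay, the other only has to be bounded. The exponent 0 is
  kept so that the case \<open>m = 0\<close> of \<open>rapid_bound\<close> matches as it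
  stands.\<close>

lemma decay_mult:
  assumes "A \<ge> 0" "0 \<le> r" "\<bar>f\<bar> * (1 + r) ^ m \<le> A" "\<bar>g\<bar> * (1 + r) ^ 0 \<le> (B::real)"
  shows "\<bar>f * g\<bar> * (1 + r) ^ m \<le> A * B"
  using mult_mono[OF assms(3,4)] assms(1,2) by (simp add: abs_mult mult_ac)

context
  fixes U :: "'a::euclidean_space \<Rightarrow> real" and V :: "'a \<Rightarrow> 'a"
  assumes UV: "rapid U V"
begin

lemma rapid_decay_products:
  fixes m :: nat
  shows "\<exists>C. \<forall>x. x \<noteq> 0 \<longrightarrow> \<bar>(U x)\<^sup>2\<bar> * (1 + norm x) ^ m \<le> C"
    and "\<exists>C. \<forall>x. x \<noteq> 0 \<longrightarrow> \<bar>U x * (V x \<bullet> x)\<bar> * (1 + norm x) ^ m \<le> C"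
    and "\<exists>C. \<forall>x. x \<noteq> 0 \<longrightarrow> \<bar>(norm x * norm (V x))\<^sup>2\<bar> * (1 + norm x) ^ m \<le> C"
proof -
  obtain C where C: "0 \<le> C" "\<And>x. x \<noteq> 0 \<Longrightarrow> \<bar>U x\<bar> * (1 + norm x) ^ m \<le> C"
    "\<And>x. x \<noteq> 0 \<Longrightarrow> norm x * norm (V x) * (1 + norm x) ^ m \<le> C" by (rule rapid_bound[OF UV]) blast
  obtain D where D: "0 \<le> D" "\<And>x. x \<noteq> 0 \<Longrightarrow> \<bar>U x\<bar> * (1 + norm x) ^ 0 \<le> D"
    "\<And>x. x \<noteq> 0 \<Longrightarrow> norm x * norm (V x) * (1 + norm x) ^ 0 \<le> D" by (rule rapid_bound[OF UV]) blast
  show "\<exists>C. \<forall>x. x \<noteq> 0 \<longrightarrow> \<bar>(U x)\<^sup>2\<bar> * (1 + norm x) ^ m \<le> C"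
    unfolding power2_eq_square by (intro exI allI impI, rule decay_mult[of C]) (use C D in auto)
  show "\<exists>C. \<forall>x. x \<noteq> 0 \<longrightarrow> \<bar>(norm x * norm (V x))\<^sup>2\<bar> * (1 + norm x) ^ m \<le> C"
    unfolding power2_eq_square
    by (intro exI allI impI, rule decay_mult[of C]) (use C D in \<open>auto simp: abs_mult\<close>)
  have "\<bar>V x \<bullet> x\<bar> * (1 + norm x) ^ 0 \<le> D" if "x \<noteq> 0" for x
    using D(3)[OF that] Cauchy_Schwarz_ineq2[of "V x" x] by (simp add: mult.commute)
  then have "\<bar>U x * (V x \<bullet> x)\<bar> * (1 + norm x) ^ m \<le> C * D" if "x \<noteq> 0" for x
    using that by (intro decay_mult C) auto
  then show "\<exists>C. \<forall>x. x \<noteq> 0 \<longrightarrow> \<bar>U x * (V x \<bullet> x)\<bar> * (1 + norm x) ^ m \<le> C" by blast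
qed

text \<open>Near the origin only \<open>norm x * norm (V x)\<close> is bounded, so the gradient
  energy costs two further powers of \<open>norm x\<close>; hence \<open>q + 2\<close> in place of
  \<open>p\<close>.\<close>

lemma rapid_integrables:
  shows rapid_integrable_U: "p < real DIM('a) \<Longrightarrow> integrable lborel (\<lambda>x. (U x)\<^sup>2 / norm x powr p)"
    and rapid_integrable_UV: "p < real DIM('a) \<Longrightarrow> integrable lborel (\<lambda>x. U x * (V x \<bullet> x) / norm x powr p)"
    and rapid_integrable_V: "q + 2 < real DIM('a) \<Longrightarrow> integrable lborel (\<lambda>x. (norm (V x))\<^sup>2 / norm x powr q)"
proof -
  note [measurable] = rapid_measurable[OF UV]
  show "p < real DIM('a) \<Longrightarrow> integrable lborel (\<lambda>x. (U x)\<^sup>2 / norm x powr p)"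
    by (rule rapid_integrable) (use rapid_decay_products in simp_all)
  show "p < real DIM('a) \<Longrightarrow> integrable lborel (\<lambda>x. U x * (V x \<bullet> x) / norm x powr p)"
    by (rule rapid_integrable) (use rapid_decay_products in simp_all)
  assume "q + 2 < real DIM('a)"
  then have "integrable lborel (\<lambda>x. (norm x * norm (V x))\<^sup>2 / norm x powr (q + 2))"
    by (intro rapid_integrable) (use rapid_decay_products in simp_all)
  then show "integrable lborel (\<lambda>x. (norm (V x))\<^sup>2 / norm x powr q)"
  proof (rule integrable_cong_AE_imp)
    show "AE x in lborel. (norm x * norm (V x))\<^sup>2 / norm x powr (q + 2) = (norm (V x))\<^sup>2 / norm x powr q"
      using AE_lborel_singleton[of "0::'a"]
      by (rule eventually_mono) (simp add: powr_add power_mult_distrib)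
  qed simp
qed

text \<open>Formally the divergence theorem for the field \<open>U^2 x / |x|^p\<close>, where
  \<open>x / |x|^p\<close> has divergence \<open>(N - p) / |x|^p\<close>. The dilation argument is
  applied to \<open>U^2\<close>, whose derivative in direction \<open>x\<close> is
  \<open>2 U (V \<bullet> x)\<close>.\<close>

lemma rapid_integration_by_parts:
  assumes p: "p < real DIM('a)"
  shows "2 * (LINT x|lborel. U x * (V x \<bullet> x) / norm x powr p)
    = (p - DIM('a)) * (LINT x|lborel. (U x)\<^sup>2 / norm x powr p)"
proof -
  note [measurable] = rapid_measurable[OF UV]
  define m where "m = nat \<lceil>real DIM('a) - p\<rceil> + 1"
  have m: "real DIM('a) < p + real m" unfolding m_def using p by (simp add: of_nat_nat) linarith
  obtain C where C: "\<And>x. x \<noteq> 0 \<Longrightarrow> \<bar>(U x)\<^sup>2\<bar> * (1 + norm x) ^ m \<le> C"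
    using rapid_decay_products(1)[of m] by blast
  obtain D where D: "\<And>x. x \<noteq> 0 \<Longrightarrow> \<bar>U x * (V x \<bullet> x)\<bar> * (1 + norm x) ^ m \<le> D"
    using rapid_decay_products(2)[of m] by blast
  have "(LINT x|lborel. 2 * (U x * (V x \<bullet> x)) / norm x powr p)
    = (p - DIM('a)) * (LINT x|lborel. (U x)\<^sup>2 / norm x powr p)"
  proof (rule integral_radial_derivative[where m = m and C = "max C (2 * D)" and f' = "\<lambda>x h. 2 * U x * (V x \<bullet> h)"])
    show "((\<lambda>x. (U x)\<^sup>2) has_derivative (\<lambda>h. 2 * U x * (V x \<bullet> h))) (at x)" if "x \<noteq> 0" for x
      by (auto intro!: derivative_eq_intros rapid_derivative[OF UV that] simp: power2_eq_square)
    show "\<bar>(U x)\<^sup>2\<bar> * (1 + norm x) ^ m \<le> max C (2 * D)" if "x \<noteq> 0" for x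
      using C[OF that] by linarith
    show "\<bar>2 * (U x * (V x \<bullet> x))\<bar> * (1 + norm x) ^ m \<le> max C (2 * D)" if "x \<noteq> 0" for x
      using D[OF that] by (simp add: abs_mult mult_ac)
  qed (use p m in auto)
  then show ?thesis by (simp flip: times_divide_eq_right)
qed

text \<open>The parameters allow two uses: \<open>k = 1\<close>, \<open>e = b - a - 1\<close> yields
  the deficit, and \<open>e = -2\<close>, where \<open>p = q = 2 * b + 2\<close>, yields Hardy's
  inequality.\<close>

lemma rapid_square_completion:
  fixes k e b p q :: real
  assumes e: "p = 2 * b - e" "q = 2 * b - 2 * e - 2" and N: "2 * b + 2 < DIM('a)" "p < DIM('a)" "q < DIM('a)"
  shows "integrable lborel (\<lambda>x. (norm (V x + (k * U x * norm x powr e) *\<^sub>R x))\<^sup>2 / norm x powr (2 * b))"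
    and "(LINT x|lborel. (norm (V x + (k * U x * norm x powr e) *\<^sub>R x))\<^sup>2 / norm x powr (2 * b)) =
      (LINT x|lborel. (norm (V x))\<^sup>2 / norm x powr (2 * b))
      + k * (p - DIM('a)) * (LINT x|lborel. (U x)\<^sup>2 / norm x powr p)
      + k\<^sup>2 * (LINT x|lborel. (U x)\<^sup>2 / norm x powr q)"
proof -
  note [measurable] = rapid_measurable[OF UV]
  let ?f = "\<lambda>x. (norm (V x))\<^sup>2 / norm x powr (2 * b) + 2 * k * (U x * (V x \<bullet> x) / norm x powr p)
     + k\<^sup>2 * ((U x)\<^sup>2 / norm x powr q)"
  let ?g = "\<lambda>x. (norm (V x + (k * U x * norm x powr e) *\<^sub>R x))\<^sup>2 / norm x powr (2 * b)"
  have eq: "AE x in lborel. ?f x = ?g x"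
    using AE_lborel_singleton[of "0::'a"]
  proof (rule eventually_mono)
    fix x :: 'a assume x: "x \<noteq> 0"
    define r where "r = norm x"
    have r: "r > 0" using x by (simp add: r_def)
    have "(norm (v + t *\<^sub>R x))\<^sup>2 = (norm v)\<^sup>2 + 2 * t * (v \<bullet> x) + t\<^sup>2 * r\<^sup>2" for v t
      unfolding r_def power2_norm_eq_inner
      by (simp add: inner_add inner_commute algebra_simps power2_eq_square)
    then have "(norm (V x + (k * U x * r powr e) *\<^sub>R x))\<^sup>2 =
        (norm (V x))\<^sup>2 + 2 * k * (U x * (V x \<bullet> x)) * r powr e + k\<^sup>2 * (U x)\<^sup>2 * ((r powr e)\<^sup>2 * r\<^sup>2)"
      by (simp add: power_mult_distrib mult_ac)
    moreover have "(r powr e)\<^sup>2 * r\<^sup>2 = r powr (2 * e + 2)"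
      using r by (simp add: powr_add powr_power mult.commute)
    moreover have "r powr e / r powr (2 * b) = 1 / r powr p"
      unfolding powr_diff[symmetric] powr_minus_divide[symmetric] by (simp add: e)
    moreover have "r powr (2 * e + 2) / r powr (2 * b) = 1 / r powr q"
      unfolding powr_diff[symmetric] powr_minus_divide[symmetric] by (simp add: e algebra_simps)
    ultimately have "(norm (V x + (k * U x * r powr e) *\<^sub>R x))\<^sup>2 / r powr (2 * b) =
        (norm (V x))\<^sup>2 / r powr (2 * b) + 2 * k * (U x * (V x \<bullet> x)) * (1 / r powr p)
        + k\<^sup>2 * (U x)\<^sup>2 * (1 / r powr q)"
      by (simp only: add_divide_distrib times_divide_eq_right[symmetric])
    then show "?f x = ?g x"
      unfolding r_def[symmetric] by simp
  qed
  have int: "integrable lborel ?f"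
    by (intro Bochner_Integration.integrable_add integrable_mult_right rapid_integrable_U
        rapid_integrable_UV rapid_integrable_V) (use N in auto)
  then show "integrable lborel ?g"
    by (rule integrable_cong_AE_imp) (use eq in auto)
  have "(LINT x|lborel. ?g x) = (LINT x|lborel. ?f x)"
    by (rule integral_cong_AE) (use eq in auto)
  also have "\<dots> = (LINT x|lborel. (norm (V x))\<^sup>2 / norm x powr (2 * b))
      + 2 * k * (LINT x|lborel. U x * (V x \<bullet> x) / norm x powr p)
      + k\<^sup>2 * (LINT x|lborel. (U x)\<^sup>2 / norm x powr q)"
    using rapid_integrable_U[OF N(2)] rapid_integrable_U[OF N(3)] rapid_integrable_UV[OF N(2)]
      rapid_integrable_V[of "2 * b"] N
    by (simp del: times_divide_eq_right)
  finally show "(LINT x|lborel. ?g x) = (LINT x|lborel. (norm (V x))\<^sup>2 / norm x powr (2 * b))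
      + k * (p - DIM('a)) * (LINT x|lborel. (U x)\<^sup>2 / norm x powr p)
      + k\<^sup>2 * (LINT x|lborel. (U x)\<^sup>2 / norm x powr q)"
    using rapid_integration_by_parts[OF N(2)] by simp
qed

text \<open>With \<open>e = -2\<close> the cross term and the last term carry the same weight, so
  nonnegativity of the square is a lower bound for every \<open>k\<close>. The chosen
  \<open>k\<close> maximises \<open>k (N - 2b - 2) - k^2\<close>.\<close>

lemma rapid_hardy:
  fixes b :: real
  assumes b: "2 * b + 2 < DIM('a)"
  shows "((DIM('a) - 2 * b - 2) / 2)\<^sup>2 * (LINT x|lborel. (U x)\<^sup>2 / norm x powr (2 * b + 2))
    \<le> (LINT x|lborel. (norm (V x))\<^sup>2 / norm x powr (2 * b))"
proof -
  note [measurable] = rapid_measurable[OF UV]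
  define k where "k = (real DIM('a) - 2 * b - 2) / 2"
  have k: "(2 * b + 2) - DIM('a) = - (2 * k)" by (simp add: k_def field_simps)
  have "0 \<le> (LINT x|lborel. (norm (V x + (k * U x * norm x powr (-2)) *\<^sub>R x))\<^sup>2 / norm x powr (2 * b))"
    by (rule Bochner_Integration.integral_nonneg) simp
  also have "\<dots> = (LINT x|lborel. (norm (V x))\<^sup>2 / norm x powr (2 * b))
      + k * ((2 * b + 2) - DIM('a)) * (LINT x|lborel. (U x)\<^sup>2 / norm x powr (2 * b + 2))
      + k\<^sup>2 * (LINT x|lborel. (U x)\<^sup>2 / norm x powr (2 * b + 2))"
    by (rule rapid_square_completion) (use b in auto)
  finally show ?thesis unfolding k k_def[symmetric] by (simp add: power2_eq_square)
qed

end

section \<open>A Poincare inequality on balls\<close>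

text \<open>The fundamental theorem of calculus applies because the segment misses the origin.
  Nonnegative integrals are used so that the bound can next be integrated over both endpoints by
  Tonelli.\<close>

lemma square_diff_le_segment_integral:
  fixes v :: "'a::euclidean_space \<Rightarrow> real" and G :: "'a \<Rightarrow> 'a"
  assumes cont: "continuous_on (- {0}) G"
    and deriv: "\<And>x. x \<noteq> 0 \<Longrightarrow> (v has_derivative (\<lambda>h. G x \<bullet> h)) (at x)"
    and avoid: "\<And>t. t \<in> {0..1} \<Longrightarrow> y + t *\<^sub>R (x - y) \<noteq> 0"
  shows "ennreal ((v x - v y)\<^sup>2) \<le> ennreal ((norm (x - y))\<^sup>2) *
    (\<integral>\<^sup>+t. ennreal ((norm (G (y + t *\<^sub>R (x - y))))\<^sup>2) * indicator {0..1} t \<partial>lborel)"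
proof -
  define \<gamma> where "\<gamma> t = y + t *\<^sub>R (x - y)" for t
  define g where "g t = G (\<gamma> t) \<bullet> (x - y)" for t
  define D where "D = v x - v y"
  let ?L = "(norm (x - y))\<^sup>2" and ?F = "\<lambda>t. (norm (G (\<gamma> t)))\<^sup>2"
  have g: "(g has_integral D) {0..1}"
  proof -
    have "((\<lambda>t. v (\<gamma> t)) has_vector_derivative g t) (at t within {0..1})" if "t \<in> {0..1}" for t
    proof -
      have "((\<lambda>t. v (\<gamma> t)) has_derivative (\<lambda>h. G (\<gamma> t) \<bullet> (h *\<^sub>R (x - y)))) (at t within {0..1})"
      proof (rule has_derivative_compose[where f = \<gamma> and g = v])
        show "(\<gamma> has_derivative (\<lambda>h. h *\<^sub>R (x - y))) (at t within {0..1})"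
          unfolding \<gamma>_def by (auto intro!: derivative_eq_intros)
        show "(v has_derivative (\<bullet>) (G (\<gamma> t))) (at (\<gamma> t))"
          by (rule deriv) (use avoid[OF that] in \<open>simp add: \<gamma>_def\<close>)
      qed
      then show ?thesis by (simp add: has_vector_derivative_def g_def)
    qed
    then have "(g has_integral v (\<gamma> 1) - v (\<gamma> 0)) {0..1}"
      by (intro fundamental_theorem_of_calculus) auto
    then show ?thesis by (simp add: \<gamma>_def D_def)
  qed
  have "continuous_on {0..1} (\<lambda>t. G (\<gamma> t))"
    using avoid by (intro continuous_on_compose2[OF cont]) (auto simp: \<gamma>_def intro!: continuous_intros)
  then have "?F integrable_on {0..1}"
    by (intro integrable_continuous_interval continuous_intros)
  then obtain I where I: "(?F has_integral I) {0..1}" by (auto simp: integrable_on_def)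
  \<comment> \<open>Cauchy-Schwarz in \<open>t\<close> without square roots:
    \<open>2 D g - D^2 \<le> g^2\<close> holds pointwise, and since \<open>g\<close> integrates to
    \<open>D\<close> the left side integrates to \<open>D^2\<close>.\<close>
  have "2 * D * D - D\<^sup>2 * 1 \<le> ?L * I"
  proof (rule has_integral_le)
    show "((\<lambda>t. 2 * D * g t - D\<^sup>2) has_integral 2 * D * D - D\<^sup>2 * 1) {0..1}"
      using has_integral_const_real[of "D\<^sup>2" 0 1]
      by (intro has_integral_diff has_integral_mult_right g) simp
    show "((\<lambda>t. ?L * ?F t) has_integral ?L * I) {0..1}"
      by (intro has_integral_mult_right I)
    show "2 * D * g t - D\<^sup>2 \<le> ?L * ?F t" for t
    proof -
      have "2 * D * g t - D\<^sup>2 \<le> (g t)\<^sup>2"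
        using zero_le_power2[of "g t - D"] by (simp add: power2_diff mult_ac)
      also have "\<dots> \<le> ?L * ?F t"
        using Cauchy_Schwarz_ineq2[of "G (\<gamma> t)" "x - y"] unfolding g_def
        by (metis abs_ge_zero mult.commute power2_abs power_mono power_mult_distrib)
      finally show ?thesis .
    qed
  qed
  then have "D\<^sup>2 \<le> ?L * I" by (simp add: power2_eq_square)
  moreover have "I \<ge> 0" using I by (rule has_integral_nonneg) simp
  ultimately have "ennreal (D\<^sup>2) \<le> ennreal ?L * ennreal I"
    by (simp add: ennreal_mult'[symmetric] ennreal_leI)
  also have "ennreal I = (\<integral>\<^sup>+t. ennreal (?F t) * indicator {0..1} t \<partial>lborel)"
    by (rule nn_integral_has_integral_lebesgue'[symmetric]) (use I in auto)
  finally show ?thesis by (simp add: D_def \<gamma>_def)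
qed

text \<open>The Jacobian \<open>t ^ DIM('a)\<close> of the substitution is at least
  \<open>2 ^ - DIM('a)\<close>. This is the origin of the dimensional factor in the Poincare
  constant.\<close>

lemma nn_integral_convex_combination_le:
  fixes F :: "'a::euclidean_space \<Rightarrow> ennreal" and t :: real
  assumes [measurable]: "F \<in> borel_measurable borel" and t: "1 / 2 \<le> t"
  shows "(\<integral>\<^sup>+x. F (z + t *\<^sub>R x) \<partial>lborel) \<le> ennreal (2 ^ DIM('a)) * integral\<^sup>N lborel F"
proof -
  let ?I = "\<integral>\<^sup>+x. F (z + t *\<^sub>R x) \<partial>lborel"
  have "1 \<le> (2 * t) ^ DIM('a)" using t by (intro one_le_power) simp
  then have "1 * ?I \<le> ennreal ((2 * t) ^ DIM('a)) * ?I"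
    by (intro mult_right_mono) simp_all
  also have "\<dots> = ennreal (2 ^ DIM('a)) * (ennreal (\<bar>t\<bar> ^ DIM('a)) * ?I)"
    using t by (simp add: power_mult_distrib ennreal_mult' mult.assoc)
  also have "ennreal (\<bar>t\<bar> ^ DIM('a)) * ?I = integral\<^sup>N lborel F"
    using t by (intro nn_integral_lborel_affine[symmetric]) auto
  finally show ?thesis by simp
qed

text \<open>A segment from \<open>y\<close> that meets 0 forces \<open>x\<close> onto the line
  spanned by \<open>y\<close>, which is a null set in dimension at least 2.\<close>

lemma AE_segment_avoids_0:
  fixes y :: "'a::euclidean_space"
  assumes "2 \<le> DIM('a)" "y \<noteq> 0"
  shows "AE x in lborel. \<forall>t\<in>{0..1}. y + t *\<^sub>R (x - y) \<noteq> 0"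
proof -
  have "dim (span {y}) < DIM('a)" using assms by (simp add: dim_singleton)
  then have "negligible (span {y})" by (rule negligible_lowdim)
  moreover have "span {y} \<in> sets lborel" by (simp add: borel_closed closed_subspace)
  ultimately have "span {y} \<in> null_sets lborel"
    by (simp only: negligible_iff_null_sets null_sets_completion_iff)
  then have "AE x in lborel. x \<notin> span {y}" by (rule AE_not_in)
  then show ?thesis
  proof (rule eventually_mono, intro ballI notI)
    fix x t assume x: "x \<notin> span {y}" and t: "y + t *\<^sub>R (x - y) = 0"
    have "t \<noteq> 0" using t assms by auto
    have "t *\<^sub>R x = (t - 1) *\<^sub>R y" using t by (simp add: algebra_simps eq_neg_iff_add_eq_0)
    then have "x = ((t - 1) / t) *\<^sub>R y"
      using \<open>t \<noteq> 0\<close> by (metis divide_inverse_commute scaleR_scaleR inverse_eq_divide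
          left_inverse scaleR_one mult.commute)
    then show False using x by (simp add: span_mul span_base)
  qed
qed

text \<open>The squared difference \<open>(v x - v y)^2\<close> is integrated over all pairs of
  points of the ball. The constant is not the mean of \<open>v\<close> but its value at a point
  \<open>y\<close> where the inner integral \<open>H y\<close> does not exceed the averaged bound.
  An infinite right side is allowed.\<close>

lemma poincare_cball:
  fixes v :: "'a::euclidean_space \<Rightarrow> real" and G :: "'a \<Rightarrow> 'a"
  assumes dim: "2 \<le> DIM('a)" and R: "R > 0"
    and cont: "continuous_on (- {0}) G"
    and deriv: "\<And>x. x \<noteq> 0 \<Longrightarrow> (v has_derivative (\<lambda>h. G x \<bullet> h)) (at x)"
  shows "\<exists>c. (\<integral>\<^sup>+x. ennreal ((v x - c)\<^sup>2) * indicator (cball 0 R) x \<partial>lborel)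
    \<le> ennreal (4 * R\<^sup>2 * 2 ^ DIM('a)) * (\<integral>\<^sup>+x. ennreal ((norm (G x))\<^sup>2) * indicator (cball 0 R) x \<partial>lborel)"
proof -
  define B where "B = cball (0::'a) R"
  have [measurable]: "B \<in> sets borel" by (simp add: B_def)
  have "continuous_on (- {0}) v"
    using deriv by (auto intro!: continuous_at_imp_continuous_on has_derivative_continuous)
  note [measurable] = borel_measurable_continuous_off_0[OF this] borel_measurable_continuous_off_0[OF cont]
  define F where "F x = ennreal ((norm (G x))\<^sup>2) * indicator B x" for x
  have [measurable]: "F \<in> borel_measurable borel" unfolding F_def by measurable
  define J where "J = integral\<^sup>N lborel F"
  let ?k = "ennreal (4 * R\<^sup>2)" and ?p = "ennreal (2 ^ DIM('a))"
  define S where "S t x y = F (y + t *\<^sub>R (x - y)) * indicator {0..1} t * indicator B x * indicator B y"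
    for t :: real and x y
  define H where "H y = (\<integral>\<^sup>+x. ennreal ((v x - v y)\<^sup>2) * indicator B x \<partial>lborel)" for y
  have [measurable]: "(\<lambda>(t, x). S t x y) \<in> borel_measurable (borel \<Otimes>\<^sub>M borel)" for y
    unfolding S_def by measurable
  have [measurable]: "(\<lambda>(t, x, y). S t x y) \<in> borel_measurable (borel \<Otimes>\<^sub>M borel \<Otimes>\<^sub>M borel)"
    unfolding S_def by measurable
  have [measurable]: "(\<lambda>y. \<integral>\<^sup>+t. \<integral>\<^sup>+x. S t x y \<partial>lborel \<partial>lborel) \<in> borel_measurable borel"
    unfolding S_def by measurable
  have [measurable]: "(\<lambda>(t, y). \<integral>\<^sup>+x. S t x y \<partial>lborel) \<in> borel_measurable (lborel \<Otimes>\<^sub>M lborel)"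
    unfolding S_def by measurable
  have [measurable]: "H \<in> borel_measurable borel" unfolding H_def by measurable
  have H_le: "H y * indicator B y \<le> ?k * (\<integral>\<^sup>+t. \<integral>\<^sup>+x. S t x y \<partial>lborel \<partial>lborel)" if "y \<noteq> 0" for y
  proof (cases "y \<in> B")
    case True
    have "H y \<le> (\<integral>\<^sup>+x. ?k * (\<integral>\<^sup>+t. S t x y \<partial>lborel) \<partial>lborel)"
      unfolding H_def
    proof (rule nn_integral_mono_AE, rule eventually_mono[OF AE_segment_avoids_0[OF dim that]])
      fix x assume avoid: "\<forall>t\<in>{0..1}. y + t *\<^sub>R (x - y) \<noteq> 0"
      show "ennreal ((v x - v y)\<^sup>2) * indicator B x \<le> ?k * (\<integral>\<^sup>+t. S t x y \<partial>lborel)"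
      proof (cases "x \<in> B")
        case x: True
        \<comment> \<open>The ball is convex, so cutting \<open>F\<close> off outside
          \<open>B\<close> loses nothing along the segment.\<close>
        have S: "ennreal ((norm (G (y + t *\<^sub>R (x - y))))\<^sup>2) * indicator {0..1} t = S t x y" for t
        proof (cases "t \<in> {0..1}")
          case t: True
          have "y + t *\<^sub>R (x - y) = (1 - t) *\<^sub>R y + t *\<^sub>R x" by (simp add: algebra_simps)
          moreover have "\<dots> \<in> B"
            using True x t unfolding B_def by (intro convexD[OF convex_cball]) auto
          ultimately show ?thesis using True x t by (simp add: S_def F_def)
        qed (simp add: S_def)
        have "norm (x - y) \<le> 2 * R"
          using norm_triangle_ineq4[of x y] x True by (simp add: B_def)
        then have "(norm (x - y))\<^sup>2 \<le> 4 * R\<^sup>2"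
          using power_mono[of "norm (x - y)" "2 * R" 2] by (simp add: power_mult_distrib)
        then have "ennreal ((norm (x - y))\<^sup>2) * (\<integral>\<^sup>+t. S t x y \<partial>lborel) \<le> ?k * (\<integral>\<^sup>+t. S t x y \<partial>lborel)"
          by (intro mult_right_mono ennreal_leI) simp_all
        with square_diff_le_segment_integral[OF cont deriv, of y x] avoid
        have "ennreal ((v x - v y)\<^sup>2) \<le> ?k * (\<integral>\<^sup>+t. S t x y \<partial>lborel)"
          unfolding S by (blast intro: order_trans)
        then show ?thesis using x by simp
      qed simp
    qed
    also have "\<dots> = ?k * (\<integral>\<^sup>+x. \<integral>\<^sup>+t. S t x y \<partial>lborel \<partial>lborel)"
      by (rule nn_integral_cmult) simp
    also have "(\<integral>\<^sup>+x. \<integral>\<^sup>+t. S t x y \<partial>lborel \<partial>lborel) = (\<integral>\<^sup>+t. \<integral>\<^sup>+x. S t x y \<partial>lborel \<partial>lborel)"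
      by (rule lborel_pair.Fubini') simp
    finally show ?thesis using True by simp
  qed simp
  have M: "(\<integral>\<^sup>+y. \<integral>\<^sup>+x. S t x y \<partial>lborel \<partial>lborel) \<le> ?p * J * emeasure lborel B * indicator {0..1} t" for t
  proof (cases "t \<in> {0..1}")
    case t: True
    have bound: "(\<integral>\<^sup>+y. (\<integral>\<^sup>+x. F (s *\<^sub>R y + r *\<^sub>R x) * indicator B y \<partial>lborel) \<partial>lborel) \<le> ?p * J * emeasure lborel B"
      if "1 / 2 \<le> r" for r s :: real
    proof -
      have "(\<integral>\<^sup>+y. (\<integral>\<^sup>+x. F (s *\<^sub>R y + r *\<^sub>R x) * indicator B y \<partial>lborel) \<partial>lborel)
          \<le> (\<integral>\<^sup>+y. ?p * J * indicator B y \<partial>lborel)"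
        by (intro nn_integral_mono)
          (auto simp: nn_integral_multc J_def intro!: mult_right_mono nn_integral_convex_combination_le that)
      then show ?thesis by (simp add: nn_integral_cmult_indicator)
    qed
    have seg: "y + t *\<^sub>R (x - y) = (1 - t) *\<^sub>R y + t *\<^sub>R x" for x y :: 'a by (simp add: algebra_simps)
    show ?thesis
    \<comment> \<open>The endpoint whose coefficient is at least 1/2 is the one substituted, which
      keeps the Jacobian away from 0 for every \<open>t\<close>.\<close>
    proof (cases "1 / 2 \<le> t")
      case True
      have "(\<integral>\<^sup>+y. \<integral>\<^sup>+x. S t x y \<partial>lborel \<partial>lborel)
          \<le> (\<integral>\<^sup>+y. (\<integral>\<^sup>+x. F ((1 - t) *\<^sub>R y + t *\<^sub>R x) * indicator B y \<partial>lborel) \<partial>lborel)"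
        by (intro nn_integral_mono) (auto simp: S_def seg indicator_def)
      then show ?thesis using bound[OF True] t by (auto intro: order_trans)
    next
      case False
      have "(\<integral>\<^sup>+y. \<integral>\<^sup>+x. S t x y \<partial>lborel \<partial>lborel) = (\<integral>\<^sup>+x. \<integral>\<^sup>+y. S t x y \<partial>lborel \<partial>lborel)"
        by (rule lborel_pair.Fubini') simp
      also have "\<dots> \<le> (\<integral>\<^sup>+x. (\<integral>\<^sup>+y. F (t *\<^sub>R x + (1 - t) *\<^sub>R y) * indicator B x \<partial>lborel) \<partial>lborel)"
        by (intro nn_integral_mono) (auto simp: S_def seg indicator_def add.commute)
      finally show ?thesis using bound[of "1 - t" t] False t by (auto intro: order_trans)
    qed
  qed (simp add: S_def)
  have "(\<integral>\<^sup>+y. H y * indicator B y \<partial>lborel)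
      \<le> (\<integral>\<^sup>+y. ?k * (\<integral>\<^sup>+t. \<integral>\<^sup>+x. S t x y \<partial>lborel \<partial>lborel) \<partial>lborel)"
    by (rule nn_integral_mono_AE, rule eventually_mono[OF AE_lborel_singleton[of "0::'a"]]) (rule H_le)
  also have "\<dots> = ?k * (\<integral>\<^sup>+y. \<integral>\<^sup>+t. \<integral>\<^sup>+x. S t x y \<partial>lborel \<partial>lborel \<partial>lborel)"
    by (rule nn_integral_cmult) simp
  also have "(\<integral>\<^sup>+y. \<integral>\<^sup>+t. \<integral>\<^sup>+x. S t x y \<partial>lborel \<partial>lborel \<partial>lborel)
      = (\<integral>\<^sup>+t. \<integral>\<^sup>+y. \<integral>\<^sup>+x. S t x y \<partial>lborel \<partial>lborel \<partial>lborel)"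
    by (rule lborel_pair.Fubini') measurable
  also have "\<dots> \<le> (\<integral>\<^sup>+t. ?p * J * emeasure lborel B * indicator {0..1::real} t \<partial>lborel)"
    by (rule nn_integral_mono) (rule M)
  also have "\<dots> = ?p * J * emeasure lborel B" by (simp add: nn_integral_cmult_indicator)
  finally have total: "(\<integral>\<^sup>+y. H y * indicator B y \<partial>lborel) \<le> ?k * (?p * J * emeasure lborel B)"
    by (simp add: mult_left_mono)
  \<comment> \<open>If \<open>H\<close> exceeded the constant everywhere, integration over
    \<open>B\<close>, of positive finite measure, would contradict \<open>total\<close>. The strict
    inequality also shows the constant to be finite in that case.\<close>
  have "\<exists>y. H y \<le> ?k * ?p * J"
  proof (rule ccontr)
    assume "\<not> ?thesis"
    then have less: "?k * ?p * J < H y" for y by (simp add: not_le)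
    have meas: "0 < emeasure lborel B" "emeasure lborel B < \<infinity>"
      using R by (simp_all add: B_def emeasure_cball)
    have "(\<integral>\<^sup>+y. ?k * ?p * J * indicator B y \<partial>lborel) < (\<integral>\<^sup>+y. H y * indicator B y \<partial>lborel)"
    proof (rule nn_integral_less)
      have "?k * ?p * J < \<infinity>" using less[of 0] by (metis infinity_ennreal_def order.strict_trans2 top_greatest)
      then show "(\<integral>\<^sup>+y. ?k * ?p * J * indicator B y \<partial>lborel) \<noteq> \<infinity>"
        using meas by (simp add: nn_integral_cmult_indicator ennreal_mult_less_top less_top)
      show "AE y in lborel. ?k * ?p * J * indicator B y \<le> H y * indicator B y"
        using less by (intro AE_I2) (auto simp: indicator_def less_imp_le)
      show "\<not> (AE y in lborel. H y * indicator B y \<le> ?k * ?p * J * indicator B y)"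
      proof
        assume "AE y in lborel. H y * indicator B y \<le> ?k * ?p * J * indicator B y"
        then have "AE y in lborel. y \<notin> B"
        proof (rule eventually_mono, intro notI)
          fix y assume "H y * indicator B y \<le> ?k * ?p * J * indicator B y" "y \<in> B"
          then have "H y \<le> ?k * ?p * J" by simp
          with less[of y] show False by (simp add: leD)
        qed
        then have "emeasure lborel B = 0" by (simp add: AE_iff_null_sets[symmetric] null_setsD1)
        then show False using meas by simp
      qed
    qed simp_all
    moreover have "(\<integral>\<^sup>+y. ?k * ?p * J * indicator B y \<partial>lborel) = ?k * (?p * J * emeasure lborel B)"
      by (subst nn_integral_cmult_indicator) (simp_all only: mult.assoc, simp)
    ultimately show False using total by (metis leD)
  qed
  then obtain y where y: "H y \<le> ?k * ?p * J" ..
  then show ?thesis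
    unfolding H_def J_def F_def B_def by (intro exI[of _ "v y"]) (simp add: ennreal_mult')
qed

section \<open>The extremal functions and the test functions\<close>

text \<open>The extremal function Phi, taken at \<open>\<sigma> = b + 1 - a\<close>. The members of
  \<open>E_set a b\<close> are the multiples of its dilates.\<close>

definition phi :: "real \<Rightarrow> 'a::euclidean_space \<Rightarrow> real" where
  "phi \<sigma> x = exp (- (1 / \<sigma>) * norm x powr \<sigma>)"

text \<open>A free \<open>k\<close> covers both \<open>phi\<close>, with
  \<open>k = - 1 / \<sigma>\<close>, and its reciprocal, with
  \<open>k = 1 / \<sigma>\<close>.\<close>

lemma has_derivative_exp_norm_powr:
  fixes x :: "'a::euclidean_space"
  assumes "x \<noteq> 0"
  shows "((\<lambda>x. exp (k * norm x powr \<sigma>)) has_derivative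
    (\<lambda>h. (k * \<sigma> * norm x powr (\<sigma> - 2) * exp (k * norm x powr \<sigma>)) *\<^sub>R x \<bullet> h)) (at x)"
proof -
  have r: "norm x > 0" using assms by simp
  have "((\<lambda>r. exp (k * r powr \<sigma>)) has_real_derivative exp (k * norm x powr \<sigma>) * (k * (\<sigma> * norm x powr (\<sigma> - 1)))) (at (norm x))"
    by (auto intro!: derivative_eq_intros r)
  then have "((\<lambda>r. exp (k * r powr \<sigma>)) has_derivative (\<lambda>h. exp (k * norm x powr \<sigma>) * (k * (\<sigma> * norm x powr (\<sigma> - 1))) * h)) (at (norm x))"
    by (simp add: has_field_derivative_def)
  from has_derivative_compose[OF has_derivative_norm[OF assms] this]
  have "((\<lambda>x. exp (k * norm x powr \<sigma>)) has_derivative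
      (\<lambda>h. exp (k * norm x powr \<sigma>) * (k * (\<sigma> * norm x powr (\<sigma> - 1))) * (sgn x \<bullet> h))) (at x)"
    by (simp add: inner_commute[of "sgn x"])
  moreover have "norm x powr (\<sigma> - 2) = norm x powr (\<sigma> - 1) * inverse (norm x)"
    using r powr_diff[of "norm x" "\<sigma> - 1" 1] by (simp add: divide_inverse)
  ultimately show ?thesis
    by (simp add: sgn_div_norm mult_ac)
qed

text \<open>The growth of the exponential enters through \<open>(1 + z / n)^n \<le> exp z\<close> at
  \<open>z = r powr \<sigma> / \<sigma>\<close>.\<close>

lemma power_mult_exp_neg_powr_bounded:
  fixes \<sigma> :: real
  assumes "\<sigma> > 0"
  shows "\<exists>C. \<forall>r>0. (1 + r) ^ m * exp (- (1 / \<sigma>) * r powr \<sigma>) \<le> C"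
proof -
  \<comment> \<open>Chosen so that \<open>m \<le> \<sigma> * n\<close>, hence
    \<open>r ^ m \<le> (r powr \<sigma>) ^ n\<close> for \<open>r > 1\<close>.\<close>
  define n where "n = nat \<lceil>real m / \<sigma>\<rceil> + 1"
  have n: "real m \<le> \<sigma> * real n" "n > 0"
  proof -
    have "real m / \<sigma> \<le> real n" unfolding n_def by (simp add: of_nat_nat) linarith
    then show "real m \<le> \<sigma> * real n" using assms by (simp add: field_simps)
  qed (simp add: n_def)
  have "(1 + r) ^ m * exp (- (1 / \<sigma>) * r powr \<sigma>) \<le> 2 ^ m + 2 ^ m * (\<sigma> * real n) ^ n" if "r > 0" for r
  proof (cases "r \<le> 1")
    case True
    have "(1 + r) ^ m * exp (- (1 / \<sigma>) * r powr \<sigma>) \<le> 2 ^ m * 1"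
      by (intro mult_mono power_mono) (use that True assms in auto)
    moreover have "0 \<le> 2 ^ m * (\<sigma> * real n) ^ n" using assms by simp
    ultimately show ?thesis by linarith
  next
    case False
    define y where "y = r powr \<sigma>"
    have y: "y > 0" using that by (simp add: y_def)
    have "(y / (\<sigma> * real n)) ^ n \<le> (1 + (y / \<sigma>) / real n) ^ n"
      using y assms by (intro power_mono) auto
    also have "\<dots> \<le> exp (y / \<sigma>)"
      by (rule exp_ge_one_plus_x_over_n_power_n) (use y assms n in \<open>auto intro: order_trans[of _ 0]\<close>)
    finally have e: "y ^ n \<le> (\<sigma> * real n) ^ n * exp (y / \<sigma>)"
      using assms n by (simp add: power_divide field_simps)
    have "r ^ m = r powr real m" using that by (simp add: powr_realpow)
    also have "\<dots> \<le> r powr (\<sigma> * real n)" using False n by (intro powr_mono) auto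
    also have "\<dots> = y ^ n" using y by (simp add: y_def powr_powr[symmetric] powr_realpow)
    finally have ry: "r ^ m \<le> y ^ n" .
    have "(1 + r) ^ m \<le> (2 * r) ^ m" using False by (intro power_mono) auto
    also have "\<dots> \<le> 2 ^ m * y ^ n" using ry by (simp add: power_mult_distrib)
    also have "\<dots> \<le> 2 ^ m * ((\<sigma> * real n) ^ n * exp (y / \<sigma>))" by (intro mult_left_mono e) auto
    finally have "(1 + r) ^ m * exp (- (y / \<sigma>)) \<le> 2 ^ m * ((\<sigma> * real n) ^ n * exp (y / \<sigma>)) * exp (- (y / \<sigma>))"
      by (rule mult_right_mono) simp
    also have "\<dots> = 2 ^ m * (\<sigma> * real n) ^ n" by (simp add: exp_minus field_simps)
    finally have "(1 + r) ^ m * exp (- (1 / \<sigma>) * r powr \<sigma>) \<le> 2 ^ m * (\<sigma> * real n) ^ n"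
      by (simp add: y_def)
    moreover have "(0::real) \<le> 2 ^ m" by simp
    ultimately show ?thesis by linarith
  qed
  then show ?thesis by blast
qed

text \<open>The gradient has size \<open>|x|^(\<sigma> - 1) phi\<close>, which is unbounded at the
  origin when \<open>\<sigma> < 1\<close>. The factor \<open>norm x\<close> in \<open>rapid\<close>
  turns it into \<open>|x|^\<sigma> phi\<close>, and \<open>j\<close> extra powers of
  \<open>1 + norm x\<close> absorb \<open>|x|^\<sigma>\<close>.\<close>

lemma rapid_phi:
  assumes s: "\<sigma> > 0"
  shows "rapid (phi \<sigma> :: 'a::euclidean_space \<Rightarrow> real) (\<lambda>x. - (norm x powr (\<sigma> - 2) * phi \<sigma> x) *\<^sub>R x)"
proof (rule rapidI)
  show "continuous_on (- {0}) (\<lambda>x::'a. - (norm x powr (\<sigma> - 2) * phi \<sigma> x) *\<^sub>R x)"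
    unfolding phi_def by (intro continuous_intros) auto
  show "(phi \<sigma> has_derivative (\<lambda>h. - (norm x powr (\<sigma> - 2) * phi \<sigma> x) *\<^sub>R x \<bullet> h)) (at x)" if "x \<noteq> 0" for x :: 'a
    using has_derivative_exp_norm_powr[OF that, of "- (1 / \<sigma>)" \<sigma>] s by (simp add: phi_def[abs_def])
  fix m
  define j where "j = nat \<lceil>\<sigma>\<rceil>"
  obtain C where C: "\<And>r. r > 0 \<Longrightarrow> (1 + r) ^ (m + j) * exp (- (1 / \<sigma>) * r powr \<sigma>) \<le> C"
    using power_mult_exp_neg_powr_bounded[OF s] by blast
  show "\<exists>C. \<forall>x::'a. x \<noteq> 0 \<longrightarrow> \<bar>phi \<sigma> x\<bar> * (1 + norm x) ^ m \<le> C \<and>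
      norm x * norm (- (norm x powr (\<sigma> - 2) * phi \<sigma> x) *\<^sub>R x) * (1 + norm x) ^ m \<le> C"
  proof (intro exI allI impI conjI)
    fix x :: 'a assume x: "x \<noteq> 0"
    have phi: "phi \<sigma> x > 0" by (simp add: phi_def)
    have D: "(1 + norm x) ^ (m + j) * phi \<sigma> x \<le> C" using C[of "norm x"] x by (simp add: phi_def)
    have one: "1 \<le> (1 + norm x) ^ j" by (simp add: one_le_power)
    have "(1 + norm x) ^ m * 1 \<le> (1 + norm x) ^ m * (1 + norm x) ^ j" by (intro mult_left_mono one) simp
    then have "(1 + norm x) ^ m * 1 * phi \<sigma> x \<le> (1 + norm x) ^ m * (1 + norm x) ^ j * phi \<sigma> x"
      by (rule mult_right_mono) (use phi in simp)
    then show "\<bar>phi \<sigma> x\<bar> * (1 + norm x) ^ m \<le> C"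
      using order_trans[OF _ D, of "phi \<sigma> x * (1 + norm x) ^ m"] phi by (simp add: power_add mult_ac)
    have "norm x * (norm x powr (\<sigma> - 2) * norm x) = norm x powr \<sigma>"
      using x powr_add[of "norm x" "\<sigma> - 2" 2] by (simp add: power2_eq_square mult_ac)
    also have "\<dots> \<le> (1 + norm x) powr \<sigma>" using s by (intro powr_mono2) auto
    also have "\<dots> \<le> (1 + norm x) powr real j" unfolding j_def by (intro powr_mono) (auto simp: of_nat_nat, linarith)
    also have "\<dots> = (1 + norm x) ^ j" by (rule powr_realpow) (simp add: add_pos_nonneg)
    finally have le: "norm x * (norm x powr (\<sigma> - 2) * norm x) \<le> (1 + norm x) ^ j" .
    have "norm x * norm (- (norm x powr (\<sigma> - 2) * phi \<sigma> x) *\<^sub>R x) * (1 + norm x) ^ m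
        = (norm x * (norm x powr (\<sigma> - 2) * norm x)) * (phi \<sigma> x * (1 + norm x) ^ m)"
      using phi by (simp add: abs_mult mult_ac)
    also have "\<dots> \<le> (1 + norm x) ^ j * (phi \<sigma> x * (1 + norm x) ^ m)"
      by (intro mult_right_mono le) (use phi in auto)
    also have "\<dots> \<le> C" using D by (simp add: power_add mult_ac)
    finally show "norm x * norm (- (norm x powr (\<sigma> - 2) * phi \<sigma> x) *\<^sub>R x) * (1 + norm x) ^ m \<le> C" .
  qed
qed

section \<open>Gradients and test functions\<close>

lemma has_derivative_grad:
  fixes f :: "real^'n \<Rightarrow> real"
  assumes "f differentiable (at x)"
  shows "(f has_derivative (\<lambda>h. grad f x \<bullet> h)) (at x)"
proof -
  let ?L = "frechet_derivative f (at x)"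
  have L: "(f has_derivative ?L) (at x)" using assms by (simp add: frechet_derivative_works)
  interpret L: bounded_linear ?L using L by (rule has_derivative_bounded_linear)
  have "?L h = grad f x \<bullet> h" for h
  proof -
    have "?L h = ?L (\<Sum>i\<in>UNIV. (h $ i) *s axis i 1)" by (simp only: basis_expansion)
    also have "\<dots> = (\<Sum>i\<in>UNIV. h $ i * ?L (axis i 1))"
      by (simp add: L.sum scalar_mult_eq_scaleR L.scaleR)
    finally show ?thesis by (simp add: grad_def inner_vec_def mult.commute)
  qed
  then have "?L = (\<lambda>h. grad f x \<bullet> h)" by auto
  then show ?thesis using L by simp
qed

text \<open>Outside the support \<open>K\<close> the function is locally zero, so its gradient
  vanishes there too. On the compact \<open>K\<close> continuity bounds every weighted
  quantity.\<close>

lemma rapid_test_function: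
  fixes f :: "real^'n \<Rightarrow> real"
  assumes "test_function f"
  shows "rapid f (grad f)"
proof -
  have "C_k (Suc 0) f" using assms unfolding test_function_def by blast
  then have diff: "f differentiable (at x)" and cg: "continuous_on UNIV (\<lambda>x. grad f x $ i)" for x i
    by (auto simp: differentiable_on_def)
  have deriv: "(f has_derivative (\<lambda>h. grad f x \<bullet> h)) (at x)" for x
    by (rule has_derivative_grad[OF diff])
  have contg: "continuous_on UNIV (grad f)"
    using continuous_on_vec_lambda[of UNIV "\<lambda>i x. grad f x $ i"] cg by simp
  have contf: "continuous_on UNIV f"
    using deriv by (auto intro!: continuous_at_imp_continuous_on has_derivative_continuous)
  define K where "K = closure {x. f x \<noteq> 0}"
  have K: "compact K" using assms by (simp add: test_function_def K_def)
  have f0: "f x = 0" if "x \<notin> K" for x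
    using that closure_subset[of "{x. f x \<noteq> 0}"] by (auto simp: K_def)
  have g0: "grad f x = 0" if "x \<notin> K" for x
  proof -
    have "(f has_derivative (\<lambda>h. 0)) (at x)"
      by (rule has_derivative_transform_within_open[where s = "- K" and f = "\<lambda>_. 0"])
        (use that f0 K in \<open>auto simp: open_Compl compact_imp_closed\<close>)
    then have "(\<lambda>h. grad f x \<bullet> h) = (\<lambda>h. 0)" by (rule has_derivative_unique[OF deriv])
    then have "grad f x \<bullet> grad f x = 0" by meson
    then show ?thesis by simp
  qed
  show ?thesis
  proof (rule rapidI)
    show "continuous_on (- {0}) (grad f)" using contg by (rule continuous_on_subset) auto
    show "(f has_derivative (\<lambda>h. grad f x \<bullet> h)) (at x)" for x by (rule deriv)
    fix m
    have "compact ((\<lambda>x. \<bar>f x\<bar> * (1 + norm x) ^ m + norm x * norm (grad f x) * (1 + norm x) ^ m) ` K)"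
      by (intro compact_continuous_image K continuous_intros continuous_on_subset[OF contf]
          continuous_on_subset[OF contg]) auto
    then obtain C where C: "\<And>x. x \<in> K \<Longrightarrow>
        \<bar>\<bar>f x\<bar> * (1 + norm x) ^ m + norm x * norm (grad f x) * (1 + norm x) ^ m\<bar> \<le> C"
      using compact_imp_bounded[THEN bounded_iff[THEN iffD1]] by fastforce
    show "\<exists>C. \<forall>x. x \<noteq> 0 \<longrightarrow> \<bar>f x\<bar> * (1 + norm x) ^ m \<le> C \<and> norm x * norm (grad f x) * (1 + norm x) ^ m \<le> C"
    proof (intro exI allI impI)
      fix x
      show "\<bar>f x\<bar> * (1 + norm x) ^ m \<le> max C 0 \<and> norm x * norm (grad f x) * (1 + norm x) ^ m \<le> max C 0"
      proof (cases "x \<in> K")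
        case True
        have "0 \<le> \<bar>f x\<bar> * (1 + norm x) ^ m" "0 \<le> norm x * norm (grad f x) * (1 + norm x) ^ m" by auto
        then show ?thesis using C[OF True] by linarith
      qed (simp add: f0 g0)
    qed
  qed
qed

section \<open>Stability for functions of rapid decay\<close>

text \<open>Relative to the middle weight \<open>r powr - p\<close>, the outer ones are
  \<open>r powr \<sigma>\<close> and \<open>r powr - \<sigma>\<close> times it. So the Hardy weight
  wins near 0, the other one far out, and a bounded range of radii remains. The factor 2 in
  \<open>2 * K\<close> leaves room for the later absorption.\<close>

lemma weight_absorption:
  fixes a b h K :: real
  assumes "h > 0" "K > 0" "a < b + 1"
  shows "\<exists>R>0. \<exists>C\<ge>0. \<forall>r>0. 2 * K / r powr (a + b + 1)
    \<le> h / r powr (2 * b + 2) + 1 / r powr (2 * a) + C * indicator {..R} r"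
proof -
  define \<sigma> where "\<sigma> = b + 1 - a"
  define p where "p = a + b + 1"
  have s: "\<sigma> > 0" using assms by (simp add: \<sigma>_def)
  \<comment> \<open>\<open>\<rho>\<close> and \<open>R\<close> are the radii at which one outer
    weight alone equals the left side: \<open>h = 2 K \<rho>^\<sigma>\<close> and
    \<open>R^\<sigma> = 2 K\<close>. The two summands of \<open>C\<close> cover both signs of
    \<open>p\<close> between these radii.\<close>
  define \<rho> where "\<rho> = (h / (2 * K)) powr (1 / \<sigma>)"
  define R where "R = (2 * K) powr (1 / \<sigma>)"
  define C where "C = 2 * K * (1 / \<rho> powr p + 1 / R powr p)"
  have pos: "\<rho> > 0" "R > 0" using assms by (auto simp: \<rho>_def R_def)
  have C: "C \<ge> 0" using assms by (simp add: C_def)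
  have "2 * K / r powr p \<le> h / r powr (2 * b + 2) + 1 / r powr (2 * a) + C * indicator {..R} r" if r: "r > 0" for r
  proof -
    have a: "1 / r powr (2 * a) = r powr \<sigma> / r powr p"
      unfolding powr_minus_divide[symmetric] powr_diff[symmetric] by (simp add: \<sigma>_def p_def algebra_simps)
    have b: "1 / r powr (2 * b + 2) = 1 / r powr \<sigma> / r powr p"
      unfolding powr_minus_divide[symmetric] powr_diff[symmetric] by (simp add: \<sigma>_def p_def algebra_simps)
    have pa: "0 \<le> 1 / r powr (2 * a)" and pb: "0 \<le> h / r powr (2 * b + 2)" using assms by auto
    have ind: "0 \<le> C * indicator {..R} r" using C by simp
    consider "R \<le> r" | "r \<le> \<rho>" | "\<rho> < r" "r < R" by linarith
    then show ?thesis
    proof cases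
      case 1
      have "2 * K = R powr \<sigma>" using s assms by (simp add: R_def powr_powr)
      also have "\<dots> \<le> r powr \<sigma>" using 1 pos s by (intro powr_mono2) auto
      finally have "2 * K / r powr p \<le> 1 / r powr (2 * a)" unfolding a by (intro divide_right_mono) auto
      then show ?thesis using pa pb ind by linarith
    next
      case 2
      have "r powr \<sigma> \<le> \<rho> powr \<sigma>" using 2 r s by (intro powr_mono2) auto
      also have "\<rho> powr \<sigma> = h / (2 * K)" using s assms by (simp add: \<rho>_def powr_powr)
      finally have "2 * K \<le> h * (1 / r powr \<sigma>)" using assms r by (simp add: field_simps)
      then have "2 * K / r powr p \<le> h * (1 / r powr \<sigma>) / r powr p" by (rule divide_right_mono) auto
      also have "\<dots> = h / r powr (2 * b + 2)" using b by (metis times_divide_eq_right mult_1_right)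
      finally have "2 * K / r powr p \<le> h / r powr (2 * b + 2)" .
      then show ?thesis using pa pb ind by linarith
    next
      case 3
      have "1 / r powr p \<le> 1 / \<rho> powr p + 1 / R powr p"
      proof (cases "p \<ge> 0")
        case True
        have "1 / r powr p \<le> 1 / \<rho> powr p"
          using True 3 pos by (intro divide_left_mono powr_mono2) auto
        then show ?thesis by (simp add: add_increasing2)
      next
        case False
        have "r powr (- p) \<le> R powr (- p)" using False 3 r by (intro powr_mono2) auto
        then show ?thesis by (simp add: powr_minus_divide add_increasing)
      qed
      then have "2 * K * (1 / r powr p) \<le> C" unfolding C_def using assms by (intro mult_left_mono) auto
      then show ?thesis using 3 pa pb by (simp add: add_nonneg_nonneg add_increasing)
    qed
  qed
  then show ?thesis unfolding p_def using pos C by blast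
qed

text \<open>For \<open>r \<le> 1\<close> the weight with the larger exponent dominates, for
  \<open>r > 1\<close> the one with the smaller.\<close>

lemma weight_interpolation:
  fixes r s p q :: real
  assumes "r > 0" "p \<le> s" "s \<le> q"
  shows "1 / r powr s \<le> 1 / r powr p + 1 / r powr q"
proof (cases "r \<le> 1")
  case True
  have "1 / r powr s \<le> 1 / r powr q"
    using assms True by (intro divide_left_mono powr_mono') auto
  then show ?thesis by (simp add: add_increasing)
next
  case False
  have "1 / r powr s \<le> 1 / r powr p"
    using assms False by (intro divide_left_mono powr_mono) auto
  then show ?thesis by (simp add: add_increasing2)
qed

lemma rapid_integrable_square:
  fixes U :: "'a::euclidean_space \<Rightarrow> real"
  assumes U: "rapid U V" and [measurable]: "S \<in> sets borel"
  shows "integrable lborel (\<lambda>x. (U x)\<^sup>2 * indicator S x)"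
proof -
  note [measurable] = rapid_measurable[OF U]
  have "integrable lborel (\<lambda>x. (U x)\<^sup>2 / norm x powr 0)"
    by (rule rapid_integrable_U[OF U]) simp
  then have "integrable lborel (\<lambda>x. (U x)\<^sup>2)"
  proof (rule integrable_cong_AE_imp)
    \<comment> \<open>\<open>0 powr 0\<close> is 0, so the weight with exponent 0 equals 1 only away
      from the origin.\<close>
    show "AE x in lborel. (U x)\<^sup>2 / norm x powr 0 = (U x)\<^sup>2"
      using AE_lborel_singleton[of "0::'a"] by (rule eventually_mono) simp
  qed simp
  then show ?thesis by (rule integrable_real_mult_indicator[rotated]) simp
qed

section \<open>The additive deficit\<close>

definition defect :: "real \<Rightarrow> real \<Rightarrow> ('a::euclidean_space \<Rightarrow> real) \<Rightarrow> ('a \<Rightarrow> 'a) \<Rightarrow> real" where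
  "defect a b U V = (LINT x|lborel. (norm (V x))\<^sup>2 / norm x powr (2 * b))
     + (LINT x|lborel. (U x)\<^sup>2 / norm x powr (2 * a))
     - (real DIM('a) - a - b - 1) * (LINT x|lborel. (U x)\<^sup>2 / norm x powr (a + b + 1))"

lemma defect_eq_square:
  fixes U :: "'a::euclidean_space \<Rightarrow> real"
  assumes "rapid U V" "a < b + 1" "2 * b + 2 < real DIM('a)"
  shows "integrable lborel (\<lambda>x. (norm (V x + (U x * norm x powr (b - a - 1)) *\<^sub>R x))\<^sup>2 / norm x powr (2 * b))"
    and "defect a b U V = (LINT x|lborel. (norm (V x + (U x * norm x powr (b - a - 1)) *\<^sub>R x))\<^sup>2 / norm x powr (2 * b))"
  using rapid_square_completion[OF assms(1), where k = 1 and b = b and e = "b - a - 1" and p = "a + b + 1" and q = "2 * a"]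
    assms by (simp_all add: defect_def algebra_simps)

lemma defect_nonneg:
  fixes U :: "'a::euclidean_space \<Rightarrow> real"
  assumes "rapid U V" "a < b + 1" "2 * b + 2 < real DIM('a)"
  shows "0 \<le> defect a b U V"
  unfolding defect_eq_square(2)[OF assms] by (rule Bochner_Integration.integral_nonneg) simp

text \<open>\<open>phi\<close> solves the first order equation
  \<open>grad Phi + Phi |x|^(b - a - 1) x = 0\<close>, so the vector inside the square is unchanged
  at every point.\<close>

lemma defect_minus_phi:
  fixes U :: "'a::euclidean_space \<Rightarrow> real"
  assumes U: "rapid U V" and ab: "a < b + 1" "2 * b + 2 < real DIM('a)"
  obtains W where "rapid (\<lambda>x. U x - c * phi (b + 1 - a) x) W"
    "defect a b (\<lambda>x. U x - c * phi (b + 1 - a) x) W = defect a b U V"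
proof
  let ?W = "\<lambda>x. V x - c *\<^sub>R (- (norm x powr (b + 1 - a - 2) * phi (b + 1 - a) x) *\<^sub>R x)"
  show W: "rapid (\<lambda>x. U x - c * phi (b + 1 - a) x) ?W"
    by (rule rapid_lincomb[OF U rapid_phi]) (use ab in auto)
  have "?W x + ((U x - c * phi (b + 1 - a) x) * norm x powr (b - a - 1)) *\<^sub>R x
      = V x + (U x * norm x powr (b - a - 1)) *\<^sub>R x" for x
    by (simp add: algebra_simps)
  then show "defect a b (\<lambda>x. U x - c * phi (b + 1 - a) x) ?W = defect a b U V"
    unfolding defect_eq_square(2)[OF W ab] defect_eq_square(2)[OF U ab] by (simp only:)
qed

text \<open>Poincare inequality for \<open>U / \<Phi>\<close> on a ball, where the weight \<open>\<Phi>\<^sup>2 |x|^(-2b)\<close> is bounded below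
  because \<open>b \<ge> 0\<close>.\<close>

lemma local_bound_by_defect:
  assumes ab: "0 \<le> b" "a < b + 1" "2 * b + 2 < real DIM('a)" and R: "R > 0"
  shows "\<exists>C\<ge>0. \<forall>(U :: 'a::euclidean_space \<Rightarrow> real) V. rapid U V \<longrightarrow>
    (\<exists>c. (LINT x|lborel. (U x - c * phi (b + 1 - a) x)\<^sup>2 * indicator (cball 0 R) x) \<le> C * defect a b U V)"
proof -
  define \<sigma> where "\<sigma> = b + 1 - a"
  have s: "\<sigma> > 0" using ab by (simp add: \<sigma>_def)
  \<comment> \<open>An upper bound on the ball for \<open>|x|^(2b) / Phi^2\<close>, the reciprocal
    of the weight; finite at the origin because \<open>b \<ge> 0\<close>.\<close>
  define M where "M = (exp (1 / \<sigma> * R powr \<sigma>))\<^sup>2 * R powr (2 * b)"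
  define P where "P = 4 * R\<^sup>2 * 2 ^ DIM('a)"
  have MP: "M \<ge> 0" "P \<ge> 0" by (auto simp: M_def P_def)
  have "\<exists>c. (LINT x|lborel. (U x - c * phi (b + 1 - a) x)\<^sup>2 * indicator (cball 0 R) x) \<le> (P * M) * defect a b U V"
    if U: "rapid U V" for U :: "'a \<Rightarrow> real" and V
  proof -
    note [measurable] = rapid_measurable[OF U]
    \<comment> \<open>\<open>?\<psi>\<close> is \<open>1 / Phi\<close>, so \<open>v\<close> is the
      quotient \<open>U / Phi\<close>, \<open>G\<close> its gradient, and \<open>D\<close> the
      vector in the square form of the deficit.\<close>
    let ?\<psi> = "\<lambda>x::'a. exp (1 / \<sigma> * norm x powr \<sigma>)"
    define D where "D x = V x + (U x * norm x powr (b - a - 1)) *\<^sub>R x" for x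
    define v where "v x = U x * ?\<psi> x" for x
    define G where "G x = ?\<psi> x *\<^sub>R D x" for x
    note D = defect_eq_square[OF U ab(2,3), folded D_def]
    have "continuous_on (- {0}) G"
      unfolding G_def D_def
      by (intro continuous_intros rapid_continuous[OF U]) auto
    moreover have "(v has_derivative (\<lambda>h. G x \<bullet> h)) (at x)" if "x \<noteq> 0" for x
    proof -
      have "(v has_derivative (\<lambda>h. U x * ((1 / \<sigma> * \<sigma> * norm x powr (\<sigma> - 2) * ?\<psi> x) *\<^sub>R x \<bullet> h) + (V x \<bullet> h) * ?\<psi> x)) (at x)"
        unfolding v_def
        by (rule has_derivative_mult[OF rapid_derivative[OF U that] has_derivative_exp_norm_powr[OF that]])
      moreover have "\<sigma> - 2 = b - a - 1" by (simp add: \<sigma>_def)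
      ultimately show ?thesis
        using s by (simp add: G_def D_def inner_add_left algebra_simps)
    qed
    ultimately obtain c where c: "(\<integral>\<^sup>+x. ennreal ((v x - c)\<^sup>2) * indicator (cball 0 R) x \<partial>lborel)
        \<le> ennreal P * (\<integral>\<^sup>+x. ennreal ((norm (G x))\<^sup>2) * indicator (cball 0 R) x \<partial>lborel)"
      using poincare_cball[of R G v] R ab unfolding P_def by auto
    let ?W = "\<lambda>x. U x - c * phi \<sigma> x"
    have rW: "rapid ?W (\<lambda>x. V x - c *\<^sub>R (- (norm x powr (\<sigma> - 2) * phi \<sigma> x) *\<^sub>R x))"
      by (rule rapid_lincomb[OF U rapid_phi[OF s]])
    have intW: "integrable lborel (\<lambda>x. (?W x)\<^sup>2 * indicator (cball 0 R) x)"
      by (rule rapid_integrable_square[OF rW]) simp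
    have W_le: "(?W x)\<^sup>2 \<le> (v x - c)\<^sup>2" for x
    proof -
      have phi: "phi \<sigma> x * ?\<psi> x = 1" by (simp add: phi_def flip: exp_add)
      have "?W x = phi \<sigma> x * (v x - c)"
        using phi by (simp add: v_def algebra_simps)
      moreover have "(phi \<sigma> x)\<^sup>2 \<le> 1" using s by (simp add: phi_def power_le_one)
      ultimately show ?thesis using mult_right_mono[of "(phi \<sigma> x)\<^sup>2" 1 "(v x - c)\<^sup>2"]
        by (simp add: power_mult_distrib)
    qed
    have G_le: "(norm (G x))\<^sup>2 \<le> M * ((norm (D x))\<^sup>2 / norm x powr (2 * b))" if "x \<noteq> 0" "norm x \<le> R" for x
    proof -
      have "norm x powr (2 * b) \<le> R powr (2 * b)" using that ab by (intro powr_mono2) auto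
      moreover have "?\<psi> x \<le> exp (1 / \<sigma> * R powr \<sigma>)"
        using that s by (auto intro!: divide_right_mono powr_mono2)
      ultimately have "(?\<psi> x)\<^sup>2 * norm x powr (2 * b) \<le> M"
        unfolding M_def by (intro mult_mono power_mono) auto
      then have "(?\<psi> x)\<^sup>2 * norm x powr (2 * b) * ((norm (D x))\<^sup>2 / norm x powr (2 * b)) \<le> M * ((norm (D x))\<^sup>2 / norm x powr (2 * b))"
        by (rule mult_right_mono) simp
      then show ?thesis using that by (simp add: G_def power_mult_distrib)
    qed
    have "ennreal (LINT x|lborel. (?W x)\<^sup>2 * indicator (cball 0 R) x) = (\<integral>\<^sup>+x. ennreal ((?W x)\<^sup>2 * indicator (cball 0 R) x) \<partial>lborel)"
      by (rule nn_integral_eq_integral[symmetric, OF intW]) simp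
    also have "\<dots> \<le> (\<integral>\<^sup>+x. ennreal ((v x - c)\<^sup>2) * indicator (cball 0 R) x \<partial>lborel)"
      by (intro nn_integral_mono) (use W_le in \<open>auto simp: indicator_def intro!: ennreal_leI\<close>)
    also have "\<dots> \<le> ennreal P * (\<integral>\<^sup>+x. ennreal ((norm (G x))\<^sup>2) * indicator (cball 0 R) x \<partial>lborel)" by (rule c)
    also have "\<dots> \<le> ennreal P * (\<integral>\<^sup>+x. ennreal (M * ((norm (D x))\<^sup>2 / norm x powr (2 * b))) \<partial>lborel)"
    proof (intro mult_left_mono nn_integral_mono_AE)
      show "AE x in lborel. ennreal ((norm (G x))\<^sup>2) * indicator (cball 0 R) x \<le> ennreal (M * ((norm (D x))\<^sup>2 / norm x powr (2 * b)))"
        using AE_lborel_singleton[of "0::'a"]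
        by (rule eventually_mono) (use G_le in \<open>auto simp: indicator_def intro!: ennreal_leI\<close>)
    qed simp
    also have "(\<integral>\<^sup>+x. ennreal (M * ((norm (D x))\<^sup>2 / norm x powr (2 * b))) \<partial>lborel) = ennreal (M * defect a b U V)"
      unfolding D(2) using MP D(1)
      by (subst nn_integral_eq_integral) (auto intro!: integrable_mult_right simp del: times_divide_eq_right)
    also have "ennreal P * ennreal (M * defect a b U V) = ennreal (P * M * defect a b U V)"
      using MP by (simp add: ennreal_mult'[symmetric] mult.assoc)
    finally have "(LINT x|lborel. (?W x)\<^sup>2 * indicator (cball 0 R) x) \<le> P * M * defect a b U V"
      using MP defect_nonneg[OF U ab(2,3)] by (subst (asm) ennreal_le_iff) auto
    then show ?thesis unfolding \<sigma>_def by blast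
  qed
  then show ?thesis using MP by (intro exI[of _ "P * M"]) auto
qed

text \<open>The argument controls both outer energies of \<open>W = U - c Phi\<close>, so one
  \<open>c\<close> serves every exponent between \<open>2 * a\<close> and \<open>2 * b + 2\<close>.
  It is used at \<open>2bN/(N - 2)\<close> and at \<open>a + b + 1\<close>.\<close>

lemma stability_rapid:
  assumes ab: "0 \<le> b" "a < b + 1" "2 * b + 2 < real DIM('a)" and s: "2 * a \<le> s" "s \<le> 2 * b + 2"
  shows "\<exists>C>0. \<forall>(U :: 'a::euclidean_space \<Rightarrow> real) V. rapid U V \<longrightarrow>
    (\<exists>c. (LINT x|lborel. (U x - c * phi (b + 1 - a) x)\<^sup>2 / norm x powr s) \<le> C * defect a b U V)"
proof -
  define h where "h = ((real DIM('a) - 2 * b - 2) / 2)\<^sup>2"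
  define K where "K = real DIM('a) - a - b - 1"
  have hK: "h > 0" "K > 0" using ab by (auto simp: h_def K_def)
  obtain R C where R: "R > 0" and C: "C \<ge> 0" and
    abs: "\<And>r. r > 0 \<Longrightarrow> 2 * K / r powr (a + b + 1) \<le> h / r powr (2 * b + 2) + 1 / r powr (2 * a) + C * indicator {..R} r"
    using weight_absorption[OF hK ab(2)] by auto
  obtain C' where C': "C' \<ge> 0" and loc: "\<And>(U :: 'a \<Rightarrow> real) V. rapid U V \<Longrightarrow>
    \<exists>c. (LINT x|lborel. (U x - c * phi (b + 1 - a) x)\<^sup>2 * indicator (cball 0 R) x) \<le> C' * defect a b U V"
    using local_bound_by_defect[OF ab R] by auto
  \<comment> \<open>\<open>2 + C * C'\<close> comes from the absorption, and
    \<open>1 + 1 / h\<close> removes the Hardy constant from the sum of the energies.\<close>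
  define B where "B = (1 + 1 / h) * (2 + C * C')"
  have B: "B > 0" using hK C C' unfolding B_def
    by (intro mult_pos_pos add_pos_nonneg) auto
  have "\<exists>c. (LINT x|lborel. (U x - c * phi (b + 1 - a) x)\<^sup>2 / norm x powr s) \<le> B * defect a b U V"
    if U: "rapid U V" for U :: "'a \<Rightarrow> real" and V
  proof -
    obtain c where c: "(LINT x|lborel. (U x - c * phi (b + 1 - a) x)\<^sup>2 * indicator (cball 0 R) x) \<le> C' * defect a b U V"
      using loc[OF U] by blast
    define W where "W x = U x - c * phi (b + 1 - a) x" for x
    obtain VW where rW: "rapid W VW" and dW: "defect a b W VW = defect a b U V"
      using defect_minus_phi[OF U ab(2,3), of c] unfolding W_def by blast
    note [measurable] = rapid_measurable[OF rW]
    let ?I = "\<lambda>p. LINT x|lborel. (W x)\<^sup>2 / norm x powr p"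
    have i: "integrable lborel (\<lambda>x. (W x)\<^sup>2 / norm x powr (2 * b + 2))"
      "integrable lborel (\<lambda>x. (W x)\<^sup>2 / norm x powr (2 * a))"
      "integrable lborel (\<lambda>x. (W x)\<^sup>2 / norm x powr (a + b + 1))"
      "integrable lborel (\<lambda>x. (W x)\<^sup>2 / norm x powr s)"
      using ab s by (auto intro!: rapid_integrable_U[OF rW])
    have iB: "integrable lborel (\<lambda>x. (W x)\<^sup>2 * indicator (cball 0 R) x)"
      by (rule rapid_integrable_square[OF rW]) simp
    have "2 * K * ?I (a + b + 1) = (LINT x|lborel. 2 * K * ((W x)\<^sup>2 / norm x powr (a + b + 1)))"
      by (simp del: times_divide_eq_right)
    also have "\<dots> \<le> (LINT x|lborel. h * ((W x)\<^sup>2 / norm x powr (2 * b + 2)) + (W x)\<^sup>2 / norm x powr (2 * a)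
        + C * ((W x)\<^sup>2 * indicator (cball 0 R) x))"
    proof (rule integral_mono_AE)
      show "AE x in lborel. 2 * K * ((W x)\<^sup>2 / norm x powr (a + b + 1)) \<le>
        h * ((W x)\<^sup>2 / norm x powr (2 * b + 2)) + (W x)\<^sup>2 / norm x powr (2 * a) + C * ((W x)\<^sup>2 * indicator (cball 0 R) x)"
        using AE_lborel_singleton[of "0::'a"]
      proof (rule eventually_mono)
        fix x :: 'a assume "x \<noteq> 0"
        then have "(W x)\<^sup>2 * (2 * K / norm x powr (a + b + 1))
            \<le> (W x)\<^sup>2 * (h / norm x powr (2 * b + 2) + 1 / norm x powr (2 * a) + C * indicator {..R} (norm x))"
          by (intro mult_left_mono abs) auto
        then show "2 * K * ((W x)\<^sup>2 / norm x powr (a + b + 1)) \<le>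
            h * ((W x)\<^sup>2 / norm x powr (2 * b + 2)) + (W x)\<^sup>2 / norm x powr (2 * a) + C * ((W x)\<^sup>2 * indicator (cball 0 R) x)"
          by (simp add: indicator_def algebra_simps add_divide_distrib)
      qed
    qed (intro Bochner_Integration.integrable_add integrable_mult_right i iB)+
    also have "\<dots> = h * ?I (2 * b + 2) + ?I (2 * a) + C * (LINT x|lborel. (W x)\<^sup>2 * indicator (cball 0 R) x)"
      using i iB by (simp del: times_divide_eq_right)
    also have "\<dots> \<le> h * ?I (2 * b + 2) + ?I (2 * a) + C * (C' * defect a b U V)"
      using c C unfolding W_def by (intro add_left_mono mult_left_mono) auto
    finally have "2 * K * ?I (a + b + 1) \<le> h * ?I (2 * b + 2) + ?I (2 * a) + C * (C' * defect a b U V)" .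
    moreover have "h * ?I (2 * b + 2) + ?I (2 * a) \<le> defect a b W VW + K * ?I (a + b + 1)"
      using rapid_hardy[OF rW ab(3)] unfolding defect_def K_def h_def by simp
    \<comment> \<open>With \<open>X\<close> the left side and \<open>T\<close> the local term,
      \<open>2 K I \<le> X + T\<close> and \<open>X \<le> defect + K I\<close> combine to
      \<open>X \<le> 2 defect + T\<close>.\<close>
    ultimately have "h * ?I (2 * b + 2) + ?I (2 * a) \<le> 2 * defect a b U V + C * (C' * defect a b U V)"
      unfolding dW by linarith
    then have E: "h * ?I (2 * b + 2) + ?I (2 * a) \<le> (2 + C * C') * defect a b U V"
      by (simp add: algebra_simps)
    have nn: "0 \<le> ?I p" for p by (rule Bochner_Integration.integral_nonneg) simp
    have "?I s \<le> (LINT x|lborel. (W x)\<^sup>2 / norm x powr (2 * a) + (W x)\<^sup>2 / norm x powr (2 * b + 2))"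
    proof (rule integral_mono_AE)
      show "AE x in lborel. (W x)\<^sup>2 / norm x powr s \<le> (W x)\<^sup>2 / norm x powr (2 * a) + (W x)\<^sup>2 / norm x powr (2 * b + 2)"
        using AE_lborel_singleton[of "0::'a"]
      proof (rule eventually_mono)
        fix x :: 'a assume "x \<noteq> 0"
        then have "(W x)\<^sup>2 * (1 / norm x powr s) \<le> (W x)\<^sup>2 * (1 / norm x powr (2 * a) + 1 / norm x powr (2 * b + 2))"
          using s by (intro mult_left_mono weight_interpolation) auto
        then show "(W x)\<^sup>2 / norm x powr s \<le> (W x)\<^sup>2 / norm x powr (2 * a) + (W x)\<^sup>2 / norm x powr (2 * b + 2)"
          by (simp add: algebra_simps)
      qed
    qed (intro Bochner_Integration.integrable_add i)+
    also have "\<dots> = ?I (2 * a) + ?I (2 * b + 2)" using i by simp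
    also have "\<dots> \<le> (1 + 1 / h) * (h * ?I (2 * b + 2) + ?I (2 * a))"
      using nn[of "2 * a"] nn[of "2 * b + 2"] hK by (simp add: field_simps)
    also have "\<dots> \<le> (1 + 1 / h) * ((2 + C * C') * defect a b U V)"
      by (intro mult_left_mono E) (use hK in auto)
    finally show ?thesis unfolding W_def B_def by (auto simp: mult.assoc)
  qed
  then show ?thesis using B by blast
qed

text \<open>Dilating \<open>U\<close> so that the two energies balance turns the additive deficit into the
  multiplicative one.\<close>

lemma scale_invariant_stability_rapid:
  assumes ab: "0 \<le> b" "a < b + 1" "2 * b + 2 < real DIM('a)"
  shows "\<exists>C>0. \<forall>(U :: 'a::euclidean_space \<Rightarrow> real) V. rapid U V \<longrightarrow>
    (\<exists>\<alpha> \<beta>. \<beta> > 0 \<and>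
      (LINT x|lborel. (U x - \<alpha> * exp (- (\<beta> / (b + 1 - a)) * norm x powr (b + 1 - a)))\<^sup>2 / norm x powr (a + b + 1))
      \<le> C * (sqrt (LINT x|lborel. (U x)\<^sup>2 / norm x powr (2 * a)) * sqrt (LINT x|lborel. (norm (V x))\<^sup>2 / norm x powr (2 * b))
         - \<bar>(real DIM('a) - a - b - 1) / 2\<bar> * (LINT x|lborel. (U x)\<^sup>2 / norm x powr (a + b + 1))))"
proof -
  define \<sigma> where "\<sigma> = b + 1 - a"
  define p where "p = a + b + 1"
  define K where "K = real DIM('a) - a - b - 1"
  have s: "\<sigma> > 0" and K: "K > 0" using ab by (auto simp: \<sigma>_def K_def)
  obtain C where C: "C > 0" and stab: "\<And>(U :: 'a \<Rightarrow> real) V. rapid U V \<Longrightarrow>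
    \<exists>c. (LINT x|lborel. (U x - c * phi \<sigma> x)\<^sup>2 / norm x powr p) \<le> C * defect a b U V"
    using stability_rapid[OF ab, of p] ab unfolding p_def \<sigma>_def by auto
  have main: "\<exists>\<alpha> \<beta>. \<beta> > 0 \<and>
      (LINT x|lborel. (U x - \<alpha> * exp (- (\<beta> / \<sigma>) * norm x powr \<sigma>))\<^sup>2 / norm x powr p)
      \<le> 2 * C * (sqrt (LINT x|lborel. (U x)\<^sup>2 / norm x powr (2 * a)) * sqrt (LINT x|lborel. (norm (V x))\<^sup>2 / norm x powr (2 * b))
         - \<bar>K / 2\<bar> * (LINT x|lborel. (U x)\<^sup>2 / norm x powr p))" if U: "rapid U V" for U :: "'a \<Rightarrow> real" and V
  proof -
    note [measurable] = rapid_measurable[OF U]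
    define N1 where "N1 = (LINT x|lborel. (norm (V x))\<^sup>2 / norm x powr (2 * b))"
    define I where "I q = (LINT x|lborel. (U x)\<^sup>2 / norm x powr q)" for q
    have nn: "N1 \<ge> 0" "I q \<ge> 0" for q
      unfolding N1_def I_def by (auto intro: Bochner_Integration.integral_nonneg)
    \<comment> \<open>One vanishing weighted integral makes \<open>U\<close> zero almost everywhere,
      hence all of them vanish.\<close>
    have I0: "I p = 0" if "I q = 0" "q < DIM('a)" for q
    proof -
      have "AE x in lborel. (U x)\<^sup>2 / norm x powr q = 0"
        using that integral_nonneg_eq_0_iff_AE[OF rapid_integrable_U[OF U, of q]] by (simp add: I_def)
      then have "AE x in lborel. (U x)\<^sup>2 / norm x powr p = 0"
        using AE_lborel_singleton[of "0::'a"] by eventually_elim simp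
      then show ?thesis unfolding I_def by (subst integral_cong_AE[where g = "\<lambda>_. 0"]) auto
    qed
    show ?thesis
    \<comment> \<open>No balancing dilation exists if an energy is 0; then \<open>I p = 0\<close>
      and \<open>\<alpha> = 0\<close> does.\<close>
    proof (cases "N1 = 0 \<or> I (2 * a) = 0")
      case True
      have "I p = 0"
      proof (cases "N1 = 0")
        case True
        have "((DIM('a) - 2 * b - 2) / 2)\<^sup>2 * I (2 * b + 2) \<le> 0"
          using rapid_hardy[OF U ab(3)] True by (simp add: N1_def I_def)
        moreover have "((DIM('a) - 2 * b - 2) / 2)\<^sup>2 > 0" using ab by simp
        ultimately have "I (2 * b + 2) = 0" using nn(2)[of "2 * b + 2"]
          by (metis mult_pos_pos not_le order_le_less)
        then show ?thesis by (rule I0) (use ab in auto)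
      next
        case False
        then have "I (2 * a) = 0" using \<open>N1 = 0 \<or> I (2 * a) = 0\<close> by simp
        then show ?thesis by (rule I0) (use ab in auto)
      qed
      then show ?thesis using True
        unfolding N1_def[symmetric] I_def[symmetric]
        by (intro exI[of _ 0] exI[of _ 1]) (auto simp: I_def[symmetric])
    next
      case False
      then have pos: "N1 > 0" "I (2 * a) > 0" using nn(1) nn(2)[of "2 * a"] by auto
      define n where "n = real DIM('a)"
      \<comment> \<open>The solution of \<open>l^(2b + 2 - n) N1 = l^(2a - n) I (2a)\<close>, which
        makes the two energies of the dilated function equal.\<close>
      define l where "l = (I (2 * a) / N1) powr (1 / (2 * \<sigma>))"
      have l: "l > 0" using pos by (simp add: l_def)
      have l2: "l powr (2 * \<sigma>) * N1 = I (2 * a)" using pos s by (simp add: l_def powr_powr)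
      define U' V' where "U' x = U (l *\<^sub>R x)" and "V' x = l *\<^sub>R V (l *\<^sub>R x)" for x
      have U': "rapid U' V'" unfolding U'_def V'_def by (rule rapid_scaleR[OF U l])
      have I': "(LINT x|lborel. (U' x)\<^sup>2 / norm x powr q) = l powr (q - n) * I q" for q
        unfolding U'_def I_def n_def by (rule integral_scaleR_powr[OF l]) simp
      have N1': "(LINT x|lborel. (norm (V' x))\<^sup>2 / norm x powr (2 * b)) = l powr (2 * b + 2 - n) * N1"
      proof -
        have "(LINT x|lborel. (norm (V' x))\<^sup>2 / norm x powr (2 * b))
            = (LINT x|lborel. l\<^sup>2 * ((norm (V (l *\<^sub>R x)))\<^sup>2 / norm x powr (2 * b)))"
          using l by (simp add: V'_def power_mult_distrib)
        also have "\<dots> = l\<^sup>2 * (l powr (2 * b - n) * N1)"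
          unfolding N1_def n_def
          by (subst integral_scaleR_powr[OF l, symmetric]) (simp_all del: times_divide_eq_right)
        also have "l\<^sup>2 = l powr 2" using l by simp
        also have "l powr 2 * (l powr (2 * b - n) * N1) = l powr (2 * b + 2 - n) * N1"
          unfolding mult.assoc[symmetric] powr_add[symmetric] by (simp add: algebra_simps)
        finally show ?thesis .
      qed
      \<comment> \<open>The weight \<open>p = a + b + 1\<close> scales by \<open>w\<close>; after
        balancing, both energies carry the same factor, so \<open>w\<close> cancels in the final
        inequality.\<close>
      define w where "w = l powr (p - n)"
      have w: "w > 0" using l by (simp add: w_def)
      have "l powr (2 * b + 2 - n) = w * l powr \<sigma>"
        unfolding w_def powr_add[symmetric] by (simp add: p_def \<sigma>_def algebra_simps)
      then have wN: "l powr (2 * b + 2 - n) * N1 = w * (l powr \<sigma> * N1)" by simp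
      have "l powr (2 * a - n) * l powr (2 * \<sigma>) = w * l powr \<sigma>"
        unfolding w_def powr_add[symmetric] by (simp add: p_def \<sigma>_def algebra_simps)
      then have wI: "l powr (2 * a - n) * I (2 * a) = w * (l powr \<sigma> * N1)"
        unfolding l2[symmetric] by simp
      have sq: "sqrt (I (2 * a)) * sqrt N1 = l powr \<sigma> * N1"
      proof (rule power2_eq_imp_eq)
        have "(l powr \<sigma>)\<^sup>2 = l powr (2 * \<sigma>)"
          unfolding power2_eq_square powr_add[symmetric] by simp
        then show "(sqrt (I (2 * a)) * sqrt N1)\<^sup>2 = (l powr \<sigma> * N1)\<^sup>2"
          unfolding power_mult_distrib using nn by (simp add: l2[symmetric] power2_eq_square[of N1])
      qed (use nn in auto)
      \<comment> \<open>Equal energies sum to twice their geometric mean; hence the constant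
        \<open>2 * C\<close>.\<close>
      have "defect a b U' V' = w * (l powr \<sigma> * N1) + w * (l powr \<sigma> * N1) - K * (w * I p)"
        unfolding defect_def I' N1' wN wI K_def[symmetric] p_def[symmetric] w_def[symmetric] by (rule refl)
      also have "\<dots> = 2 * w * (l powr \<sigma> * N1 - K / 2 * I p)" by (simp add: right_diff_distrib)
      finally have defect: "defect a b U' V' = 2 * w * (sqrt (I (2 * a)) * sqrt N1 - \<bar>K / 2\<bar> * I p)"
        unfolding sq using K by simp
      obtain c where c: "(LINT x|lborel. (U' x - c * phi \<sigma> x)\<^sup>2 / norm x powr p) \<le> C * defect a b U' V'"
        using stab[OF U'] by blast
      \<comment> \<open>Undoing the dilation turns \<open>phi \<sigma>\<close> into the exponential
        with parameter \<open>l powr (- \<sigma>)\<close>.\<close>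
      define \<beta> where "\<beta> = l powr (- \<sigma>)"
      define g where "g x = (U x - c * exp (- (\<beta> / \<sigma>) * norm x powr \<sigma>))\<^sup>2" for x
      have [measurable]: "g \<in> borel_measurable borel" unfolding g_def by measurable
      have g: "(U' x - c * phi \<sigma> x)\<^sup>2 = g (l *\<^sub>R x)" for x
      proof -
        have "norm (l *\<^sub>R x) powr \<sigma> = l powr \<sigma> * norm x powr \<sigma>" using l by (simp add: powr_mult)
        then have e: "- (\<beta> / \<sigma>) * norm (l *\<^sub>R x) powr \<sigma> = - (1 / \<sigma>) * norm x powr \<sigma>"
          using l by (simp add: \<beta>_def powr_minus)
        show ?thesis unfolding g_def U'_def phi_def e ..
      qed
      have "(LINT x|lborel. (U' x - c * phi \<sigma> x)\<^sup>2 / norm x powr p) = w * (LINT x|lborel. g x / norm x powr p)"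
        unfolding g w_def n_def by (rule integral_scaleR_powr[OF l]) simp
      then have "w * (LINT x|lborel. g x / norm x powr p) \<le> w * (2 * C * (sqrt (I (2 * a)) * sqrt N1 - \<bar>K / 2\<bar> * I p))"
        using c unfolding defect by (simp add: mult_ac)
      then have "(LINT x|lborel. g x / norm x powr p) \<le> 2 * C * (sqrt (I (2 * a)) * sqrt N1 - \<bar>K / 2\<bar> * I p)"
        using w by simp
      then show ?thesis unfolding g_def I_def N1_def
        by (intro exI[of _ c] exI[of _ \<beta>]) (use l in \<open>simp add: \<beta>_def\<close>)
    qed
  qed
  show ?thesis
    by (rule exI[of _ "2 * C"], intro conjI allI impI)
      (use C in simp, rule main[unfolded p_def \<sigma>_def K_def])
qed

section \<open>Convergence in weighted L2 spaces\<close>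

text \<open>Convergence of the extended integrals already makes one difference
  \<open>f n - g\<close> square integrable, hence \<open>g\<close> too. The energies converge
  because the difference of the squares is at most
  \<open>(1 + 1/\<epsilon>) |f - g|^2 + \<epsilon> |g|^2\<close>.\<close>

lemma weighted_L2_limit:
  fixes f :: "nat \<Rightarrow> 'b \<Rightarrow> 'c::euclidean_space"
  assumes [measurable]: "\<And>n. f n \<in> borel_measurable M" "g \<in> borel_measurable M" "w \<in> borel_measurable M"
    and w: "\<And>x. 0 \<le> w x"
    and int: "\<And>n. integrable M (\<lambda>x. (norm (f n x))\<^sup>2 / w x)"
    and lim: "(\<lambda>n. \<integral>\<^sup>+x. ennreal ((norm (f n x - g x))\<^sup>2 / w x) \<partial>M) \<longlonglongrightarrow> 0"
  shows "integrable M (\<lambda>x. (norm (g x))\<^sup>2 / w x)"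
    and "integrable M (\<lambda>x. (norm (f n x - g x))\<^sup>2 / w x)"
    and "(\<lambda>n. LINT x|M. (norm (f n x - g x))\<^sup>2 / w x) \<longlonglongrightarrow> 0"
    and "(\<lambda>n. LINT x|M. (norm (f n x))\<^sup>2 / w x) \<longlonglongrightarrow> (LINT x|M. (norm (g x))\<^sup>2 / w x)"
proof -
  have two: "(norm (u + v))\<^sup>2 \<le> 2 * (norm u)\<^sup>2 + 2 * (norm v)\<^sup>2" for u v :: 'c
  proof -
    have "(norm (u + v))\<^sup>2 \<le> (norm u + norm v)\<^sup>2" by (intro power_mono norm_triangle_ineq) simp
    also have "\<dots> \<le> 2 * (norm u)\<^sup>2 + 2 * (norm v)\<^sup>2"
      using zero_le_power2[of "norm u - norm v"] by (simp add: power2_sum power2_diff)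
    finally show ?thesis .
  qed
  have intI: "integrable M (\<lambda>x. (norm (u x + v x))\<^sup>2 / w x)"
    if [measurable]: "u \<in> borel_measurable M" "v \<in> borel_measurable M"
      and i: "integrable M (\<lambda>x. (norm (u x))\<^sup>2 / w x)" "integrable M (\<lambda>x. (norm (v x))\<^sup>2 / w x)" for u v :: "'b \<Rightarrow> 'c"
  proof (rule Bochner_Integration.integrable_bound)
    show "integrable M (\<lambda>x. 2 * ((norm (u x))\<^sup>2 / w x) + 2 * ((norm (v x))\<^sup>2 / w x))"
      by (intro Bochner_Integration.integrable_add integrable_mult_right i)
    have "(norm (u x + v x))\<^sup>2 / w x \<le> 2 * ((norm (u x))\<^sup>2 / w x) + 2 * ((norm (v x))\<^sup>2 / w x)" for x
      using divide_right_mono[OF two[of "u x" "v x"] w[of x]] by (simp add: add_divide_distrib)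
    then show "AE x in M. norm ((norm (u x + v x))\<^sup>2 / w x) \<le> norm (2 * ((norm (u x))\<^sup>2 / w x) + 2 * ((norm (v x))\<^sup>2 / w x))"
      using w by (intro AE_I2) (auto intro: order_trans)
  qed measurable
  obtain n0 where "(\<integral>\<^sup>+x. ennreal ((norm (f n0 x - g x))\<^sup>2 / w x) \<partial>M) < 1"
    using order_tendstoD(2)[OF lim, of 1] by (auto simp: eventually_sequentially)
  then have "integrable M (\<lambda>x. (norm (f n0 x - g x))\<^sup>2 / w x)"
    using w by (intro integrableI_bounded) (auto intro: order.strict_trans)
  then have "integrable M (\<lambda>x. (norm (g x - f n0 x))\<^sup>2 / w x)" by (simp add: norm_minus_commute)
  from intI[OF _ _ this int[of n0]]
  show g: "integrable M (\<lambda>x. (norm (g x))\<^sup>2 / w x)" by simp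
  have d: "integrable M (\<lambda>x. (norm (f n x - g x))\<^sup>2 / w x)" for n
    using intI[of "f n" "\<lambda>x. - g x"] int[of n] g by simp
  then show "integrable M (\<lambda>x. (norm (f n x - g x))\<^sup>2 / w x)" .
  define E where "E n = (LINT x|M. (norm (f n x - g x))\<^sup>2 / w x)" for n
  define A where "A = (LINT x|M. (norm (g x))\<^sup>2 / w x)"
  have E0: "E n \<ge> 0" for n unfolding E_def using w by (auto intro: Bochner_Integration.integral_nonneg)
  have "(\<lambda>n. ennreal (E n)) \<longlonglongrightarrow> 0"
    using lim unfolding E_def by (subst (asm) nn_integral_eq_integral[OF d]) (use w in auto)
  then show E: "E \<longlonglongrightarrow> 0" using E0 by (simp add: tendsto_ennreal_iff flip: ennreal_0)
  \<comment> \<open>This tends to 0 slowly enough that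
    \<open>E n / \<epsilon> n \<le> sqrt (E n)\<close>; the added reciprocal keeps it positive when
    \<open>E n = 0\<close>.\<close>
  define \<epsilon> where "\<epsilon> n = sqrt (E n) + inverse (real (Suc n))" for n
  have \<epsilon>: "\<epsilon> n > 0" for n using E0 unfolding \<epsilon>_def by (simp add: add_nonneg_pos)
  have "\<bar>(LINT x|M. (norm (f n x))\<^sup>2 / w x) - A\<bar> \<le> E n + sqrt (E n) + \<epsilon> n * A" for n
  proof -
    have "\<bar>(norm (f n x))\<^sup>2 / w x - (norm (g x))\<^sup>2 / w x\<bar>
        \<le> (1 + 1 / \<epsilon> n) * ((norm (f n x - g x))\<^sup>2 / w x) + \<epsilon> n * ((norm (g x))\<^sup>2 / w x)" for x
    proof -
      let ?u = "f n x - g x" and ?e = "\<epsilon> n"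
      have "(norm (f n x))\<^sup>2 = (norm ?u)\<^sup>2 + 2 * (?u \<bullet> g x) + (norm (g x))\<^sup>2"
        unfolding power2_norm_eq_inner by (simp add: inner_diff inner_commute)
      then have "\<bar>(norm (f n x))\<^sup>2 - (norm (g x))\<^sup>2\<bar> \<le> (norm ?u)\<^sup>2 + 2 * \<bar>?u \<bullet> g x\<bar>"
        using zero_le_power2[of "norm ?u"] by linarith
      also have "2 * \<bar>?u \<bullet> g x\<bar> \<le> 2 * (norm ?u * norm (g x))"
        using Cauchy_Schwarz_ineq2[of ?u "g x"] by simp
      also have "2 * (norm ?u * norm (g x)) \<le> (norm ?u)\<^sup>2 / ?e + ?e * (norm (g x))\<^sup>2"
      proof -
        have "0 \<le> (norm ?u - ?e * norm (g x))\<^sup>2 / ?e" using \<epsilon>[of n] by simp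
        also have "\<dots> = (norm ?u)\<^sup>2 / ?e + ?e * (norm (g x))\<^sup>2 - 2 * (norm ?u * norm (g x))"
          using \<epsilon>[of n] by (simp add: power2_eq_square field_simps)
        finally show ?thesis by simp
      qed
      finally have "\<bar>(norm (f n x))\<^sup>2 - (norm (g x))\<^sup>2\<bar> / w x
          \<le> ((norm ?u)\<^sup>2 + ((norm ?u)\<^sup>2 / ?e + ?e * (norm (g x))\<^sup>2)) / w x"
        using w by (intro divide_right_mono) auto
      then show ?thesis using w[of x]
        by (simp add: diff_divide_distrib[symmetric] abs_divide add_divide_distrib algebra_simps)
    qed
    then have "(LINT x|M. \<bar>(norm (f n x))\<^sup>2 / w x - (norm (g x))\<^sup>2 / w x\<bar>)
        \<le> (LINT x|M. (1 + 1 / \<epsilon> n) * ((norm (f n x - g x))\<^sup>2 / w x) + \<epsilon> n * ((norm (g x))\<^sup>2 / w x))"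
      by (intro Bochner_Integration.integral_mono Bochner_Integration.integrable_abs
          Bochner_Integration.integrable_diff Bochner_Integration.integrable_add integrable_mult_right int g d)
    also have "\<dots> = (1 + 1 / \<epsilon> n) * E n + \<epsilon> n * A"
      unfolding E_def A_def using g d[of n] by (simp del: times_divide_eq_right)
    finally have "\<bar>(LINT x|M. (norm (f n x))\<^sup>2 / w x) - A\<bar> \<le> (1 + 1 / \<epsilon> n) * E n + \<epsilon> n * A"
      unfolding A_def
      using integral_abs_bound[of M "\<lambda>x. (norm (f n x))\<^sup>2 / w x - (norm (g x))\<^sup>2 / w x"] int[of n] g by simp
    moreover have "E n / \<epsilon> n \<le> sqrt (E n)"
    proof -
      have "E n = sqrt (E n) * sqrt (E n)" using E0[of n] by simp
      also have "\<dots> \<le> sqrt (E n) * \<epsilon> n" unfolding \<epsilon>_def using E0[of n] by (intro mult_left_mono) auto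
      finally show ?thesis using \<epsilon>[of n] by (simp add: pos_divide_le_eq)
    qed
    ultimately show ?thesis by (simp add: algebra_simps)
  qed
  then have le: "\<forall>\<^sub>F n in sequentially. norm ((LINT x|M. (norm (f n x))\<^sup>2 / w x) - A)
      \<le> E n + sqrt (E n) + \<epsilon> n * A"
    by (intro always_eventually allI) (simp only: real_norm_def)
  have "(\<lambda>n. E n + sqrt (E n) + \<epsilon> n * A) \<longlonglongrightarrow> 0 + sqrt 0 + (sqrt 0 + 0) * A"
    unfolding \<epsilon>_def by (intro tendsto_intros E LIMSEQ_inverse_real_of_nat)
  then have "(\<lambda>n. E n + sqrt (E n) + \<epsilon> n * A) \<longlonglongrightarrow> 0" by simp
  from Lim_null_comparison[OF le this]
  have "(\<lambda>n. (LINT x|M. (norm (f n x))\<^sup>2 / w x) - A) \<longlonglongrightarrow> 0" .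
  then show "(\<lambda>n. LINT x|M. (norm (f n x))\<^sup>2 / w x) \<longlonglongrightarrow> (LINT x|M. (norm (g x))\<^sup>2 / w x)"
    unfolding A_def by (simp add: LIM_zero_iff)
qed

section \<open>Passage to the completion\<close>

lemma AE_lebesgue_nonzero: "AE x::'a::euclidean_space in lebesgue. x \<noteq> 0"
  by (rule AE_completion[OF AE_lborel_singleton])

lemma borel_measurable_lebesgue_id [measurable]: "(\<lambda>x::'a::euclidean_space. x) \<in> borel_measurable lebesgue"
  by (rule measurable_completion) simp

lemma rapid_measurable_lebesgue:
  assumes "rapid U V"
  shows "U \<in> borel_measurable lebesgue" "V \<in> borel_measurable lebesgue"
  using rapid_measurable[OF assms] by (auto intro: measurable_completion)

text \<open>Hardy's inequality for \<open>U - U'\<close>, with both gradients compared to a common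
  \<open>Du\<close>. The constant is the Hardy factor \<open>4 / (N - 2b - 2)^2\<close> times 2 from
  squaring the triangle inequality.\<close>

lemma rapid_hardy_difference:
  fixes U U' :: "'a::euclidean_space \<Rightarrow> real" and b :: real
  assumes U: "rapid U V" "rapid U' V'" and b: "2 * b + 2 < DIM('a)"
    and [measurable]: "Du \<in> borel_measurable lebesgue"
  shows "(\<integral>\<^sup>+x. ennreal ((norm (U x - U' x))\<^sup>2 / norm x powr (2 * b + 2)) \<partial>lebesgue)
    \<le> ennreal (8 / (DIM('a) - 2 * b - 2)\<^sup>2) *
      ((\<integral>\<^sup>+x. ennreal ((norm (V x - Du x))\<^sup>2 / norm x powr (2 * b)) \<partial>lebesgue)
       + (\<integral>\<^sup>+x. ennreal ((norm (V' x - Du x))\<^sup>2 / norm x powr (2 * b)) \<partial>lebesgue))"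
proof -
  note [measurable] = U[THEN rapid_measurable_lebesgue(2)]
  define k where "k = (real DIM('a) - 2 * b - 2)\<^sup>2"
  have k: "k > 0" using b by (simp add: k_def)
  have r: "rapid (\<lambda>x. U x - 1 * U' x) (\<lambda>x. V x - 1 *\<^sub>R V' x)" by (rule rapid_lincomb[OF U])
  have "((DIM('a) - 2 * b - 2) / 2)\<^sup>2 * (LINT x|lborel. (U x - 1 * U' x)\<^sup>2 / norm x powr (2 * b + 2))
    \<le> (LINT x|lborel. (norm (V x - 1 *\<^sub>R V' x))\<^sup>2 / norm x powr (2 * b))"
    using rapid_hardy[OF r b] by simp
  then have "(k / 4) * (LINT x|lborel. (U x - U' x)\<^sup>2 / norm x powr (2 * b + 2))
    \<le> (LINT x|lborel. (norm (V x - V' x))\<^sup>2 / norm x powr (2 * b))"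
    by (simp add: k_def power_divide)
  then have le: "(LINT x|lborel. (U x - U' x)\<^sup>2 / norm x powr (2 * b + 2))
    \<le> 4 / k * (LINT x|lborel. (norm (V x - V' x))\<^sup>2 / norm x powr (2 * b))"
    using k by (simp add: field_simps)
  have "(\<integral>\<^sup>+x. ennreal ((norm (U x - U' x))\<^sup>2 / norm x powr (2 * b + 2)) \<partial>lebesgue)
      = ennreal (LINT x|lborel. (U x - U' x)\<^sup>2 / norm x powr (2 * b + 2))"
    unfolding nn_integral_completion real_norm_def power2_abs
    using rapid_integrable_U[OF r b] by (intro nn_integral_eq_integral) auto
  also have "\<dots> \<le> ennreal (4 / k * (LINT x|lborel. (norm (V x - V' x))\<^sup>2 / norm x powr (2 * b)))"
    by (rule ennreal_leI[OF le])
  also have "\<dots> = ennreal (4 / k) * ennreal (LINT x|lborel. (norm (V x - V' x))\<^sup>2 / norm x powr (2 * b))"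
    by (rule ennreal_mult') (use k in simp)
  also have "ennreal (LINT x|lborel. (norm (V x - V' x))\<^sup>2 / norm x powr (2 * b))
      = (\<integral>\<^sup>+x. ennreal ((norm (V x - V' x))\<^sup>2 / norm x powr (2 * b)) \<partial>lebesgue)"
    unfolding nn_integral_completion
    using rapid_integrable_V[OF r b] by (intro nn_integral_eq_integral[symmetric]) auto
  also have "\<dots> \<le> (\<integral>\<^sup>+x. 2 * (ennreal ((norm (V x - Du x))\<^sup>2 / norm x powr (2 * b))
      + ennreal ((norm (V' x - Du x))\<^sup>2 / norm x powr (2 * b))) \<partial>lebesgue)"
  proof (rule nn_integral_mono)
    fix x :: 'a
    have "norm (V x - V' x) \<le> norm (V x - Du x) + norm (V' x - Du x)"
      by (metis dist_norm dist_triangle2)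
    then have "(norm (V x - V' x))\<^sup>2 \<le> (norm (V x - Du x) + norm (V' x - Du x))\<^sup>2"
      by (rule power_mono) simp
    also have "\<dots> \<le> 2 * ((norm (V x - Du x))\<^sup>2 + (norm (V' x - Du x))\<^sup>2)"
      using zero_le_power2[of "norm (V x - Du x) - norm (V' x - Du x)"]
      by (simp add: power2_sum power2_diff)
    finally have "(norm (V x - V' x))\<^sup>2 / norm x powr (2 * b)
        \<le> 2 * ((norm (V x - Du x))\<^sup>2 + (norm (V' x - Du x))\<^sup>2) / norm x powr (2 * b)"
      by (rule divide_right_mono) simp
    then have "ennreal ((norm (V x - V' x))\<^sup>2 / norm x powr (2 * b))
        \<le> ennreal (2 * ((norm (V x - Du x))\<^sup>2 / norm x powr (2 * b) + (norm (V' x - Du x))\<^sup>2 / norm x powr (2 * b)))"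
      by (intro ennreal_leI) (simp add: add_divide_distrib)
    also have "\<dots> = 2 * (ennreal ((norm (V x - Du x))\<^sup>2 / norm x powr (2 * b))
        + ennreal ((norm (V' x - Du x))\<^sup>2 / norm x powr (2 * b)))"
      by (subst ennreal_mult', simp, subst ennreal_plus, simp, simp, simp)
    finally show "ennreal ((norm (V x - V' x))\<^sup>2 / norm x powr (2 * b)) \<le> \<dots>" .
  qed
  also have "\<dots> = 2 * ((\<integral>\<^sup>+x. ennreal ((norm (V x - Du x))\<^sup>2 / norm x powr (2 * b)) \<partial>lebesgue)
       + (\<integral>\<^sup>+x. ennreal ((norm (V' x - Du x))\<^sup>2 / norm x powr (2 * b)) \<partial>lebesgue))"
    by (simp add: nn_integral_cmult nn_integral_add)
  finally have "(\<integral>\<^sup>+x. ennreal ((norm (U x - U' x))\<^sup>2 / norm x powr (2 * b + 2)) \<partial>lebesgue)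
    \<le> ennreal (4 / k) * (2 * ((\<integral>\<^sup>+x. ennreal ((norm (V x - Du x))\<^sup>2 / norm x powr (2 * b)) \<partial>lebesgue)
       + (\<integral>\<^sup>+x. ennreal ((norm (V' x - Du x))\<^sup>2 / norm x powr (2 * b)) \<partial>lebesgue)))"
    by (simp only: mult_left_mono zero_le)
  moreover have "ennreal (4 / k) * 2 = ennreal (8 / k)"
    using k by (simp add: ennreal_mult'[symmetric] flip: ennreal_numeral)
  ultimately show ?thesis unfolding mult.assoc[symmetric] k_def by (simp only:)
qed

text \<open>Fatou's lemma along an almost everywhere convergent subsequence.\<close>

lemma hardy_limit:
  fixes u :: "'a::euclidean_space \<Rightarrow> real" and a b :: real
  assumes rapid: "\<And>n. rapid (U n) (V n)"
    and [measurable]: "u \<in> borel_measurable lebesgue" "Du \<in> borel_measurable lebesgue"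
    and ab: "2 * a < DIM('a)" "2 * b + 2 < DIM('a)"
    and limV: "(\<lambda>n. \<integral>\<^sup>+x. ennreal ((norm (V n x - Du x))\<^sup>2 / norm x powr (2 * b)) \<partial>lebesgue) \<longlonglongrightarrow> 0"
    and limU: "(\<lambda>n. \<integral>\<^sup>+x. ennreal ((norm (U n x - u x))\<^sup>2 / norm x powr (2 * a)) \<partial>lebesgue) \<longlonglongrightarrow> 0"
  shows "(\<lambda>n. \<integral>\<^sup>+x. ennreal ((norm (U n x - u x))\<^sup>2 / norm x powr (2 * b + 2)) \<partial>lebesgue) \<longlonglongrightarrow> 0"
proof -
  note [measurable] = rapid[THEN rapid_measurable_lebesgue(1)]
  have intU: "integrable lebesgue (\<lambda>x. (norm (U n x))\<^sup>2 / norm x powr (2 * a))" for n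
    using rapid_integrable_U[OF rapid[of n] ab(1)] by (simp add: integrable_completion rapid_measurable[OF rapid[of n]])
  have L2: "integrable lebesgue (\<lambda>x. (norm (U n x - u x))\<^sup>2 / norm x powr (2 * a))"
    "(\<lambda>n. LINT x|lebesgue. (norm (U n x - u x))\<^sup>2 / norm x powr (2 * a)) \<longlonglongrightarrow> 0" for n
    by (rule weighted_L2_limit[OF _ _ _ _ intU limU]; simp)+
  have "(\<lambda>n. LINT x|lebesgue. norm ((norm (U n x - u x))\<^sup>2 / norm x powr (2 * a))) \<longlonglongrightarrow> 0"
    using L2(2) by simp
  from tendsto_L1_AE_subseq[OF L2(1) this]
  obtain r where r: "strict_mono r"
    "AE x in lebesgue. (\<lambda>n. (norm (U (r n) x - u x))\<^sup>2 / norm x powr (2 * a)) \<longlonglongrightarrow> 0"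
    by blast
  define k where "k = ennreal (8 / (DIM('a) - 2 * b - 2)\<^sup>2)"
  define e where "e n = (\<integral>\<^sup>+x. ennreal ((norm (V n x - Du x))\<^sup>2 / norm x powr (2 * b)) \<partial>lebesgue)" for n
  have e: "e \<longlonglongrightarrow> 0" using limV unfolding e_def .
  \<comment> \<open>The index \<open>n\<close> stays fixed while the second one runs along the
    subsequence, so the Cauchy estimate for differences becomes an estimate against
    \<open>u\<close>.\<close>
  have le: "(\<integral>\<^sup>+x. ennreal ((norm (U n x - u x))\<^sup>2 / norm x powr (2 * b + 2)) \<partial>lebesgue) \<le> k * e n" for n
  proof -
    let ?F = "\<lambda>j x. ennreal ((norm (U n x - U (r j) x))\<^sup>2 / norm x powr (2 * b + 2))"
    have "AE x in lebesgue. ennreal ((norm (U n x - u x))\<^sup>2 / norm x powr (2 * b + 2)) = liminf (\<lambda>j. ?F j x)"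
      using r(2) AE_lebesgue_nonzero
    proof eventually_elim
      case (elim x)
      \<comment> \<open>Off the origin the weight is a positive constant in \<open>j\<close> and can
        be multiplied away, leaving pointwise convergence of \<open>U (r j)\<close>.\<close>
      have "(\<lambda>j. (norm (U (r j) x - u x))\<^sup>2 / norm x powr (2 * a) * norm x powr (2 * a)) \<longlonglongrightarrow> 0 * norm x powr (2 * a)"
        by (intro tendsto_mult_right elim)
      then have "(\<lambda>j. (norm (U (r j) x - u x))\<^sup>2) \<longlonglongrightarrow> 0" using elim by simp
      then have "(\<lambda>j. sqrt ((norm (U (r j) x - u x))\<^sup>2)) \<longlonglongrightarrow> sqrt 0" by (rule tendsto_real_sqrt)
      then have "(\<lambda>j. norm (U (r j) x - u x)) \<longlonglongrightarrow> 0" by simp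
      then have "(\<lambda>j. U (r j) x) \<longlonglongrightarrow> u x" by (simp only: tendsto_norm_zero_iff LIM_zero_iff)
      then have "(\<lambda>j. ?F j x) \<longlonglongrightarrow> ennreal ((norm (U n x - u x))\<^sup>2 / norm x powr (2 * b + 2))"
        using elim by (intro tendsto_ennrealI tendsto_intros) auto
      then show ?case by (rule lim_imp_Liminf[rotated, symmetric]) simp
    qed
    then have "(\<integral>\<^sup>+x. ennreal ((norm (U n x - u x))\<^sup>2 / norm x powr (2 * b + 2)) \<partial>lebesgue)
        = (\<integral>\<^sup>+x. liminf (\<lambda>j. ?F j x) \<partial>lebesgue)"
      by (rule nn_integral_cong_AE)
    also have "\<dots> \<le> liminf (\<lambda>j. \<integral>\<^sup>+x. ?F j x \<partial>lebesgue)"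
      by (rule nn_integral_liminf) measurable
    also have "\<dots> \<le> liminf (\<lambda>j. k * (e n + e (r j)))"
      unfolding k_def e_def
      by (intro Liminf_mono always_eventually allI rapid_hardy_difference rapid ab(2)) simp
    also have "\<dots> = k * (e n + 0)"
    proof (rule lim_imp_Liminf)
      have "(\<lambda>j. e (r j)) \<longlonglongrightarrow> 0" using LIMSEQ_subseq_LIMSEQ[OF e r(1)] by (simp add: o_def)
      then show "(\<lambda>j. k * (e n + e (r j))) \<longlonglongrightarrow> k * (e n + 0)"
        by (intro ennreal_tendsto_cmult tendsto_add tendsto_const) (simp add: k_def)
    qed simp
    finally show ?thesis by simp
  qed
  have "(\<lambda>n. k * e n) \<longlonglongrightarrow> k * 0"
    by (intro ennreal_tendsto_cmult e) (simp add: k_def)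
  then have lim: "(\<lambda>n. k * e n) \<longlonglongrightarrow> 0" by simp
  show ?thesis
    by (rule tendsto_sandwich[OF _ _ tendsto_const lim]) (simp, rule always_eventually, rule allI, rule le)
qed

text \<open>Convergence at \<open>2 * a\<close> is part of the definition, at
  \<open>2 * b + 2\<close> it follows from Hardy's inequality, and weight interpolation fills in the
  exponents between.\<close>

lemma X_space_approximation:
  fixes u :: "real^'n \<Rightarrow> real"
  assumes X: "(u, Du) \<in> X_space a b" and ab: "a < b + 1" "2 * b + 2 < DIM(real^'n)"
  obtains U V where "u \<in> borel_measurable lebesgue" "Du \<in> borel_measurable lebesgue"
    "\<And>n. rapid (U n) (V n)"
    "(\<lambda>n. \<integral>\<^sup>+x. ennreal ((norm (V n x - Du x))\<^sup>2 / norm x powr (2 * b)) \<partial>lebesgue) \<longlonglongrightarrow> 0"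
    "\<And>q. 2 * a \<le> q \<Longrightarrow> q \<le> 2 * b + 2 \<Longrightarrow>
      (\<lambda>n. \<integral>\<^sup>+x. ennreal ((norm (U n x - u x))\<^sup>2 / norm x powr q) \<partial>lebesgue) \<longlonglongrightarrow> 0"
proof -
  from X obtain U where [measurable]: "u \<in> borel_measurable lebesgue" "Du \<in> borel_measurable lebesgue"
    and test: "\<And>n. test_function (U n)"
    and lim: "(\<lambda>n. (\<integral>\<^sup>+x. ennreal ((norm (grad (U n) x - Du x))\<^sup>2 / norm x powr (2 * b)) \<partial>lebesgue)
           + (\<integral>\<^sup>+x. ennreal ((norm (U n x - u x))\<^sup>2 / norm x powr (2 * a)) \<partial>lebesgue)) \<longlonglongrightarrow> 0"
    unfolding X_space_def real_norm_def by blast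
  have rapid: "rapid (U n) (grad (U n))" for n by (rule rapid_test_function[OF test])
  note [measurable] = rapid[THEN rapid_measurable_lebesgue(1)]
  have limV: "(\<lambda>n. \<integral>\<^sup>+x. ennreal ((norm (grad (U n) x - Du x))\<^sup>2 / norm x powr (2 * b)) \<partial>lebesgue) \<longlonglongrightarrow> 0"
    by (rule tendsto_sandwich[OF _ _ tendsto_const lim]) (simp_all add: add_increasing2)
  have limU: "(\<lambda>n. \<integral>\<^sup>+x. ennreal ((norm (U n x - u x))\<^sup>2 / norm x powr (2 * a)) \<partial>lebesgue) \<longlonglongrightarrow> 0"
    by (rule tendsto_sandwich[OF _ _ tendsto_const lim]) (simp_all add: add_increasing)
  have limH: "(\<lambda>n. \<integral>\<^sup>+x. ennreal ((norm (U n x - u x))\<^sup>2 / norm x powr (2 * b + 2)) \<partial>lebesgue) \<longlonglongrightarrow> 0"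
    by (rule hardy_limit[OF rapid _ _ _ _ limV limU]) (use ab in auto)
  have "(\<lambda>n. \<integral>\<^sup>+x. ennreal ((norm (U n x - u x))\<^sup>2 / norm x powr q) \<partial>lebesgue) \<longlonglongrightarrow> 0"
    if q: "2 * a \<le> q" "q \<le> 2 * b + 2" for q
  proof (rule tendsto_sandwich[OF _ _ tendsto_const])
    show "(\<lambda>n. (\<integral>\<^sup>+x. ennreal ((norm (U n x - u x))\<^sup>2 / norm x powr (2 * a)) \<partial>lebesgue)
        + (\<integral>\<^sup>+x. ennreal ((norm (U n x - u x))\<^sup>2 / norm x powr (2 * b + 2)) \<partial>lebesgue)) \<longlonglongrightarrow> 0"
      using tendsto_add[OF limU limH] by simp
    show "\<forall>\<^sub>F n in sequentially. (\<integral>\<^sup>+x. ennreal ((norm (U n x - u x))\<^sup>2 / norm x powr q) \<partial>lebesgue)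
      \<le> (\<integral>\<^sup>+x. ennreal ((norm (U n x - u x))\<^sup>2 / norm x powr (2 * a)) \<partial>lebesgue)
        + (\<integral>\<^sup>+x. ennreal ((norm (U n x - u x))\<^sup>2 / norm x powr (2 * b + 2)) \<partial>lebesgue)"
    proof (intro always_eventually allI)
      fix n
      have "AE x in lebesgue. ennreal ((norm (U n x - u x))\<^sup>2 / norm x powr q)
          \<le> ennreal ((norm (U n x - u x))\<^sup>2 / norm x powr (2 * a)) + ennreal ((norm (U n x - u x))\<^sup>2 / norm x powr (2 * b + 2))"
        using AE_lebesgue_nonzero
      proof eventually_elim
        case (elim x)
        have "(norm (U n x - u x))\<^sup>2 * (1 / norm x powr q)
            \<le> (norm (U n x - u x))\<^sup>2 * (1 / norm x powr (2 * a) + 1 / norm x powr (2 * b + 2))"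
          using elim q by (intro mult_left_mono weight_interpolation) auto
        then have "ennreal ((norm (U n x - u x))\<^sup>2 / norm x powr q)
          \<le> ennreal ((norm (U n x - u x))\<^sup>2 / norm x powr (2 * a) + (norm (U n x - u x))\<^sup>2 / norm x powr (2 * b + 2))"
          by (intro ennreal_leI) (simp add: algebra_simps)
        then show ?case by simp
      qed
      from nn_integral_mono_AE[OF this]
      show "(\<integral>\<^sup>+x. ennreal ((norm (U n x - u x))\<^sup>2 / norm x powr q) \<partial>lebesgue)
        \<le> (\<integral>\<^sup>+x. ennreal ((norm (U n x - u x))\<^sup>2 / norm x powr (2 * a)) \<partial>lebesgue)
          + (\<integral>\<^sup>+x. ennreal ((norm (U n x - u x))\<^sup>2 / norm x powr (2 * b + 2)) \<partial>lebesgue)"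
        by (subst (asm) nn_integral_add) simp_all
    qed
  qed simp
  then show thesis using that[of U "\<lambda>n. grad (U n)"] rapid limV by simp
qed

section \<open>Limits of the stability estimates\<close>

text \<open>The comparison function found for \<open>U n\<close> is used for \<open>u\<close> as
  well: the infimum lies below its distance to \<open>u\<close>, so the chosen indices need not
  converge. The index set is the reals for the first inequality and \<open>E_set a b\<close> for the
  second.\<close>

lemma stability_limit:
  fixes U :: "nat \<Rightarrow> 'a::euclidean_space \<Rightarrow> real" and v :: "'i \<Rightarrow> 'a \<Rightarrow> real"
  assumes [measurable]: "\<And>n. U n \<in> borel_measurable lebesgue" "u \<in> borel_measurable lebesgue"
    "\<And>i. i \<in> I \<Longrightarrow> v i \<in> borel_measurable lebesgue"
    and intU: "\<And>n. integrable lebesgue (\<lambda>x. (norm (U n x))\<^sup>2 / norm x powr s)"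
    and intv: "\<And>i. i \<in> I \<Longrightarrow> integrable lebesgue (\<lambda>x. (v i x)\<^sup>2 / norm x powr s)"
    and lim: "(\<lambda>n. \<integral>\<^sup>+x. ennreal ((norm (U n x - u x))\<^sup>2 / norm x powr s) \<partial>lebesgue) \<longlonglongrightarrow> 0"
    and d: "d \<longlonglongrightarrow> D"
    and le: "\<And>n. \<exists>i\<in>I. (LINT x|lebesgue. (U n x - v i x)\<^sup>2 / norm x powr s) \<le> C * d n"
  shows "(INF i\<in>I. LINT x|lebesgue. \<bar>u x - v i x\<bar>\<^sup>2 / norm x powr s) \<le> 2 * C * D"
proof -
  let ?w = "\<lambda>x::'a. norm x powr s"
  note L2 = weighted_L2_limit[of U lebesgue u ?w, OF _ _ _ _ intU lim]
  define E where "E n = (LINT x|lebesgue. (norm (U n x - u x))\<^sup>2 / ?w x)" for n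
  have E: "E \<longlonglongrightarrow> 0" unfolding E_def by (rule L2(3)) auto
  have two: "(p + q)\<^sup>2 \<le> 2 * p\<^sup>2 + 2 * q\<^sup>2" for p q :: real
    using zero_le_power2[of "p - q"] by (simp add: power2_sum power2_diff)
  have "(INF i\<in>I. LINT x|lebesgue. \<bar>u x - v i x\<bar>\<^sup>2 / ?w x) \<le> 2 * (C * d n) + 2 * E n" for n
  proof -
    obtain i where i: "i \<in> I" "(LINT x|lebesgue. (U n x - v i x)\<^sup>2 / ?w x) \<le> C * d n" using le by blast
    note [measurable] = assms(3)[OF i(1)]
    have iv: "integrable lebesgue (\<lambda>x. (U n x - v i x)\<^sup>2 / ?w x)"
    proof (rule Bochner_Integration.integrable_bound)
      show "integrable lebesgue (\<lambda>x. 2 * ((norm (U n x))\<^sup>2 / ?w x) + 2 * ((v i x)\<^sup>2 / ?w x))"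
        by (intro Bochner_Integration.integrable_add integrable_mult_right intU intv i)
      have "(U n x - v i x)\<^sup>2 / ?w x \<le> 2 * ((norm (U n x))\<^sup>2 / ?w x) + 2 * ((v i x)\<^sup>2 / ?w x)" for x
        using divide_right_mono[OF two[of "U n x" "- v i x"], of "?w x"] by (simp add: add_divide_distrib)
      then show "AE x in lebesgue. norm ((U n x - v i x)\<^sup>2 / ?w x)
          \<le> norm (2 * ((norm (U n x))\<^sup>2 / ?w x) + 2 * ((v i x)\<^sup>2 / ?w x))"
        by (intro AE_I2) (auto intro: order_trans[OF _ abs_ge_self])
    qed measurable
    have iu: "integrable lebesgue (\<lambda>x. (norm (U n x - u x))\<^sup>2 / ?w x)" by (rule L2(2)) auto
    have "(INF i\<in>I. LINT x|lebesgue. \<bar>u x - v i x\<bar>\<^sup>2 / ?w x) \<le> (LINT x|lebesgue. \<bar>u x - v i x\<bar>\<^sup>2 / ?w x)"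
      by (rule cINF_lower[OF bdd_belowI[of _ 0] i(1)]) (auto intro!: Bochner_Integration.integral_nonneg)
    also have "\<dots> \<le> (LINT x|lebesgue. 2 * ((U n x - v i x)\<^sup>2 / ?w x) + 2 * ((norm (U n x - u x))\<^sup>2 / ?w x))"
    proof (rule integral_mono')
      show "integrable lebesgue (\<lambda>x. 2 * ((U n x - v i x)\<^sup>2 / ?w x) + 2 * ((norm (U n x - u x))\<^sup>2 / ?w x))"
        by (intro Bochner_Integration.integrable_add integrable_mult_right iv iu)
      show "\<bar>u x - v i x\<bar>\<^sup>2 / ?w x \<le> 2 * ((U n x - v i x)\<^sup>2 / ?w x) + 2 * ((norm (U n x - u x))\<^sup>2 / ?w x)" for x
        using divide_right_mono[OF two[of "U n x - v i x" "u x - U n x"], of "?w x"]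
        by (simp add: add_divide_distrib power2_commute[of "u x" "U n x"])
    qed auto
    also have "\<dots> = 2 * (LINT x|lebesgue. (U n x - v i x)\<^sup>2 / ?w x) + 2 * E n"
      unfolding E_def using iv iu by (simp del: times_divide_eq_right)
    also have "\<dots> \<le> 2 * (C * d n) + 2 * E n" using i(2) by simp
    finally show ?thesis .
  qed
  moreover have "(\<lambda>n. 2 * (C * d n) + 2 * E n) \<longlonglongrightarrow> 2 * (C * D) + 2 * 0"
    by (intro tendsto_intros d E)
  ultimately have "(INF i\<in>I. LINT x|lebesgue. \<bar>u x - v i x\<bar>\<^sup>2 / ?w x) \<le> 2 * (C * D) + 2 * 0"
    by (intro LIMSEQ_le_const) auto
  then show ?thesis by simp
qed

text \<open>Each energy converges separately, so both deficits pass to the limit term by term;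
  \<open>a + b + 1\<close> is among the admissible exponents \<open>q\<close>.\<close>

lemma X_space_energy_approximation:
  fixes u :: "real^'n \<Rightarrow> real"
  assumes X: "(u, Du) \<in> X_space a b" and ab: "a < b + 1" "2 * b + 2 < real CARD('n)"
  obtains U V where "u \<in> borel_measurable lebesgue" "\<And>n. rapid (U n) (V n)"
    "(\<lambda>n. LINT x|lborel. (norm (V n x))\<^sup>2 / norm x powr (2 * b))
      \<longlonglongrightarrow> (LINT x|lebesgue. (norm (Du x))\<^sup>2 / norm x powr (2 * b))"
    "\<And>q. 2 * a \<le> q \<Longrightarrow> q \<le> 2 * b + 2 \<Longrightarrow>
      (\<lambda>n. \<integral>\<^sup>+x. ennreal ((norm (U n x - u x))\<^sup>2 / norm x powr q) \<partial>lebesgue) \<longlonglongrightarrow> 0"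
    "\<And>q. 2 * a \<le> q \<Longrightarrow> q \<le> 2 * b + 2 \<Longrightarrow>
      (\<lambda>n. LINT x|lborel. (U n x)\<^sup>2 / norm x powr q) \<longlonglongrightarrow> (LINT x|lebesgue. \<bar>u x\<bar>\<^sup>2 / norm x powr q)"
proof -
  have b: "2 * b + 2 < DIM(real^'n)" using ab by simp
  obtain U V where u [measurable]: "u \<in> borel_measurable lebesgue" "Du \<in> borel_measurable lebesgue"
    and rapid: "\<And>n. rapid (U n) (V n)"
    and limV: "(\<lambda>n. \<integral>\<^sup>+x. ennreal ((norm (V n x - Du x))\<^sup>2 / norm x powr (2 * b)) \<partial>lebesgue) \<longlonglongrightarrow> 0"
    and limU: "\<And>q. 2 * a \<le> q \<Longrightarrow> q \<le> 2 * b + 2 \<Longrightarrow>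
      (\<lambda>n. \<integral>\<^sup>+x. ennreal ((norm (U n x - u x))\<^sup>2 / norm x powr q) \<partial>lebesgue) \<longlonglongrightarrow> 0"
    using X_space_approximation[OF X ab(1) b] by blast
  note [measurable] = rapid[THEN rapid_measurable(1)] rapid[THEN rapid_measurable(2)]
    rapid[THEN rapid_measurable_lebesgue(1)] rapid[THEN rapid_measurable_lebesgue(2)]
  have V: "(\<lambda>n. LINT x|lborel. (norm (V n x))\<^sup>2 / norm x powr (2 * b))
      \<longlonglongrightarrow> (LINT x|lebesgue. (norm (Du x))\<^sup>2 / norm x powr (2 * b))"
  proof -
    have "integrable lebesgue (\<lambda>x. (norm (V n x))\<^sup>2 / norm x powr (2 * b))" for n
      using rapid_integrable_V[OF rapid[of n] b] by (simp add: integrable_completion)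
    from weighted_L2_limit(4)[OF _ _ _ _ this limV]
    have "(\<lambda>n. LINT x|lebesgue. (norm (V n x))\<^sup>2 / norm x powr (2 * b))
      \<longlonglongrightarrow> (LINT x|lebesgue. (norm (Du x))\<^sup>2 / norm x powr (2 * b))" by simp
    then show ?thesis by (simp add: integral_completion)
  qed
  have W: "(\<lambda>n. LINT x|lborel. (U n x)\<^sup>2 / norm x powr q) \<longlonglongrightarrow> (LINT x|lebesgue. \<bar>u x\<bar>\<^sup>2 / norm x powr q)"
    if q: "2 * a \<le> q" "q \<le> 2 * b + 2" for q
  proof -
    have "q < DIM(real^'n)" using q b by simp
    then have "integrable lebesgue (\<lambda>x. (norm (U n x))\<^sup>2 / norm x powr q)" for n
      using rapid_integrable_U[OF rapid[of n]] by (simp add: integrable_completion)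
    from weighted_L2_limit(4)[OF _ _ _ _ this limU[OF q]]
    have "(\<lambda>n. LINT x|lebesgue. (norm (U n x))\<^sup>2 / norm x powr q)
      \<longlonglongrightarrow> (LINT x|lebesgue. (norm (u x))\<^sup>2 / norm x powr q)" by simp
    then show ?thesis by (simp add: integral_completion)
  qed
  show thesis by (rule that[OF u(1) rapid V limU W])
qed

theorem theorem3p6:
  fixes N :: nat and a b :: real
  assumes "N = CARD('n::finite)"
    and "0 \<le> b" and "b < (real N - 2) / 2" and "a \<le> real N * b / (real N - 2)"
  shows "(\<exists>C1>0. \<forall>(u :: real^'n \<Rightarrow> real, Du) \<in> X_space a b.
            (LINT x|lebesgue. (norm (Du x))\<^sup>2 / norm x powr (2 * b))
            + (LINT x|lebesgue. \<bar>u x\<bar>\<^sup>2 / norm x powr (2 * a))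
            - (real N - a - b - 1) * (LINT x|lebesgue. \<bar>u x\<bar>\<^sup>2 / norm x powr (a + b + 1))
            \<ge> C1 * (INF c. LINT x|lebesgue.
                 \<bar>u x - c * exp (- (1 / (b + 1 - a)) * norm x powr (b + 1 - a))\<bar>\<^sup>2
                 / norm x powr (2 * b * real N / (real N - 2))))
       \<and> (a + b + 1 = 2 * b * real N / (real N - 2) \<longrightarrow>
          (\<exists>C2>0. \<forall>(u :: real^'n \<Rightarrow> real, Du) \<in> X_space a b.
            delta1 a b u Du
            \<ge> C2 * (INF v\<in>E_set a b. LINT x|lebesgue.
                 \<bar>u x - v x\<bar>\<^sup>2 / norm x powr (a + b + 1))))"
proof -
  have N: "real N = real DIM(real^'n)" "real N > 2" using assms by auto
  define s where "s = 2 * b * real N / (real N - 2)"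
  have s: "s * (real N - 2) = 2 * b * real N" using N by (simp add: s_def)
  \<comment> \<open>Multiplied by \<open>N - 2\<close>, the bound on \<open>a\<close> becomes
    \<open>2a \<le> s\<close> and the upper bound on \<open>b\<close> becomes
    \<open>s < 2b + 2\<close>; together they give \<open>a < b + 1\<close>.\<close>
  have "2 * a * (real N - 2) \<le> s * (real N - 2)"
    using assms(4) N unfolding s by (simp add: pos_le_divide_eq mult.commute[of b])
  then have as: "2 * a \<le> s" using N by simp
  have "s * (real N - 2) < (2 * b + 2) * (real N - 2)"
    using assms(3) unfolding s by (simp add: algebra_simps)
  then have sb: "s < 2 * b + 2" using N by (simp add: mult_less_cancel_right)
  have ab: "0 \<le> b" "a < b + 1" "2 * b + 2 < real DIM(real^'n)"
    using assms as sb by auto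
  have b: "2 * b + 2 < real CARD('n)" using assms by simp
  let ?e = "\<lambda>\<beta> x. exp (- (\<beta> / (b + 1 - a)) * norm x powr (b + 1 - a))"
  \<comment> \<open>The dilation by \<open>l\<close> with \<open>l powr \<sigma> = \<beta>\<close>
    carries \<open>phi\<close> to the general exponential, which inherits its decay.\<close>
  have int_e: "integrable lebesgue (\<lambda>x::real^'n. (c * ?e \<beta> x)\<^sup>2 / norm x powr q)"
    and meas_e: "(\<lambda>x::real^'n. c * ?e \<beta> x) \<in> borel_measurable lebesgue"
    if "\<beta> > 0" "q \<le> 2 * b + 2" for c \<beta> q
  proof -
    define \<sigma> where "\<sigma> = b + 1 - a"
    define l where "l = \<beta> powr (1 / \<sigma>)"
    have \<sigma>: "\<sigma> > 0" and l: "l > 0" using ab that by (simp_all add: \<sigma>_def l_def)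
    have "l powr \<sigma> = \<beta>" using \<sigma> that by (simp add: l_def powr_powr)
    then have e: "phi \<sigma> (l *\<^sub>R x) = ?e \<beta> x" for x :: "real^'n"
      using l by (simp add: phi_def powr_mult \<sigma>_def)
    note r = rapid_scaleR[OF rapid_phi[OF \<sigma>, where 'a = "real^'n"] l]
    have "integrable lborel (\<lambda>x::real^'n. c\<^sup>2 * ((?e \<beta> x)\<^sup>2 / norm x powr q))"
      using rapid_integrable_U[OF r, of q] that ab unfolding e by (intro integrable_mult_right) simp
    then have "integrable lborel (\<lambda>x::real^'n. (c * ?e \<beta> x)\<^sup>2 / norm x powr q)"
      by (simp add: power_mult_distrib)
    then show "integrable lebesgue (\<lambda>x::real^'n. (c * ?e \<beta> x)\<^sup>2 / norm x powr q)"
      by (subst integrable_completion) simp_all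
    show "(\<lambda>x::real^'n. c * ?e \<beta> x) \<in> borel_measurable lebesgue" by measurable
  qed
  have lborel: "(LINT x|lebesgue. (U x - c * ?e \<beta> x)\<^sup>2 / norm x powr q) = (LINT x|lborel. (U x - c * ?e \<beta> x)\<^sup>2 / norm x powr q)"
    if "rapid U V" for U :: "real^'n \<Rightarrow> real" and V c \<beta> q
  proof -
    note [measurable] = rapid_measurable[OF that]
    have "(\<lambda>x. (U x - c * ?e \<beta> x)\<^sup>2 / norm x powr q) \<in> borel_measurable borel" by measurable
    then show ?thesis by (simp add: integral_completion)
  qed
  show ?thesis
  proof (intro conjI impI)
    obtain C where C: "C > 0" and stab: "\<And>(U :: real^'n \<Rightarrow> real) V. rapid U V \<Longrightarrow>
        \<exists>c. (LINT x|lborel. (U x - c * phi (b + 1 - a) x)\<^sup>2 / norm x powr s) \<le> C * defect a b U V"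
      using stability_rapid[OF ab as less_imp_le[OF sb]] by blast
    \<comment> \<open>The bound for the approximants has constant \<open>C\<close>; the 2 is the
      loss in \<open>stability_limit\<close>.\<close>
    have "1 / (2 * C) * (INF c. LINT x|lebesgue. \<bar>u x - c * ?e 1 x\<bar>\<^sup>2 / norm x powr s)
        \<le> (LINT x|lebesgue. (norm (Du x))\<^sup>2 / norm x powr (2 * b))
            + (LINT x|lebesgue. \<bar>u x\<bar>\<^sup>2 / norm x powr (2 * a))
            - (real N - a - b - 1) * (LINT x|lebesgue. \<bar>u x\<bar>\<^sup>2 / norm x powr (a + b + 1))"
        (is "_ \<le> ?D")
      if X: "(u, Du) \<in> X_space a b" for u :: "real^'n \<Rightarrow> real" and Du
    proof -
      obtain U V where u: "u \<in> borel_measurable lebesgue" and rapid: "\<And>n. rapid (U n) (V n)"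
        and lim: "(\<lambda>n. LINT x|lborel. (norm (V n x))\<^sup>2 / norm x powr (2 * b))
          \<longlonglongrightarrow> (LINT x|lebesgue. (norm (Du x))\<^sup>2 / norm x powr (2 * b))"
        "\<And>q. 2 * a \<le> q \<Longrightarrow> q \<le> 2 * b + 2 \<Longrightarrow>
          (\<lambda>n. \<integral>\<^sup>+x. ennreal ((norm (U n x - u x))\<^sup>2 / norm x powr q) \<partial>lebesgue) \<longlonglongrightarrow> 0"
        "\<And>q. 2 * a \<le> q \<Longrightarrow> q \<le> 2 * b + 2 \<Longrightarrow>
          (\<lambda>n. LINT x|lborel. (U n x)\<^sup>2 / norm x powr q) \<longlonglongrightarrow> (LINT x|lebesgue. \<bar>u x\<bar>\<^sup>2 / norm x powr q)"
        using X_space_energy_approximation[OF X ab(2) b] by blast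
      have d: "(\<lambda>n. defect a b (U n) (V n)) \<longlonglongrightarrow> ?D"
        unfolding defect_def N(1) using ab by (intro tendsto_intros lim) auto
      have "(INF c. LINT x|lebesgue. \<bar>u x - c * ?e 1 x\<bar>\<^sup>2 / norm x powr s) \<le> 2 * C * ?D"
      proof (rule stability_limit[OF _ u _ _ _ lim(2) d])
        show "U n \<in> borel_measurable lebesgue" for n by (rule rapid_measurable_lebesgue[OF rapid])
        show "integrable lebesgue (\<lambda>x. (norm (U n x))\<^sup>2 / norm x powr s)" for n
          using rapid_integrable_U[OF rapid[of n], of s] rapid_measurable[OF rapid[of n]] sb ab
          by (simp add: integrable_completion)
        show "\<exists>c\<in>UNIV. (LINT x|lebesgue. (U n x - c * ?e 1 x)\<^sup>2 / norm x powr s) \<le> C * defect a b (U n) (V n)" for n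
          unfolding lborel[OF rapid[of n]] using stab[OF rapid[of n]] by (simp add: phi_def)
      qed (use as sb int_e[of 1 s] meas_e[of 1 s] in simp_all)
      then show ?thesis using C by (simp add: field_simps)
    qed
    then show "\<exists>C1>0. \<forall>(u :: real^'n \<Rightarrow> real, Du) \<in> X_space a b.
            (LINT x|lebesgue. (norm (Du x))\<^sup>2 / norm x powr (2 * b))
            + (LINT x|lebesgue. \<bar>u x\<bar>\<^sup>2 / norm x powr (2 * a))
            - (real N - a - b - 1) * (LINT x|lebesgue. \<bar>u x\<bar>\<^sup>2 / norm x powr (a + b + 1))
            \<ge> C1 * (INF c. LINT x|lebesgue.
                 \<bar>u x - c * exp (- (1 / (b + 1 - a)) * norm x powr (b + 1 - a))\<bar>\<^sup>2
                 / norm x powr (2 * b * real N / (real N - 2)))"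
      unfolding s_def[symmetric] using C by (intro exI[of _ "1 / (2 * C)"] conjI ballI) (simp, fast)
  next
    obtain C where C: "C > 0" and stab: "\<And>(U :: real^'n \<Rightarrow> real) V. rapid U V \<Longrightarrow>
        \<exists>\<alpha> \<beta>. \<beta> > 0 \<and> (LINT x|lborel. (U x - \<alpha> * ?e \<beta> x)\<^sup>2 / norm x powr (a + b + 1))
      \<le> C * (sqrt (LINT x|lborel. (U x)\<^sup>2 / norm x powr (2 * a)) * sqrt (LINT x|lborel. (norm (V x))\<^sup>2 / norm x powr (2 * b))
         - \<bar>(real DIM(real^'n) - a - b - 1) / 2\<bar> * (LINT x|lborel. (U x)\<^sup>2 / norm x powr (a + b + 1)))"
      using scale_invariant_stability_rapid[OF ab] by blast
    \<comment> \<open>The same limit argument, with the comparison functions ranging over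
      \<open>E_set a b\<close> and \<open>?d n\<close> the multiplicative deficit of the
      approximant.\<close>
    have "1 / (2 * C) * (INF v\<in>E_set a b. LINT x|lebesgue. \<bar>u x - v x\<bar>\<^sup>2 / norm x powr (a + b + 1)) \<le> delta1 a b u Du"
      if X: "(u, Du) \<in> X_space a b" for u :: "real^'n \<Rightarrow> real" and Du
    proof -
      obtain U V where u: "u \<in> borel_measurable lebesgue" and rapid: "\<And>n. rapid (U n) (V n)"
        and lim: "(\<lambda>n. LINT x|lborel. (norm (V n x))\<^sup>2 / norm x powr (2 * b))
          \<longlonglongrightarrow> (LINT x|lebesgue. (norm (Du x))\<^sup>2 / norm x powr (2 * b))"
        "\<And>q. 2 * a \<le> q \<Longrightarrow> q \<le> 2 * b + 2 \<Longrightarrow>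
          (\<lambda>n. \<integral>\<^sup>+x. ennreal ((norm (U n x - u x))\<^sup>2 / norm x powr q) \<partial>lebesgue) \<longlonglongrightarrow> 0"
        "\<And>q. 2 * a \<le> q \<Longrightarrow> q \<le> 2 * b + 2 \<Longrightarrow>
          (\<lambda>n. LINT x|lborel. (U n x)\<^sup>2 / norm x powr q) \<longlonglongrightarrow> (LINT x|lebesgue. \<bar>u x\<bar>\<^sup>2 / norm x powr q)"
        using X_space_energy_approximation[OF X ab(2) b] by blast
      let ?d = "\<lambda>n. sqrt (LINT x|lborel. (U n x)\<^sup>2 / norm x powr (2 * a)) * sqrt (LINT x|lborel. (norm (V n x))\<^sup>2 / norm x powr (2 * b))
         - \<bar>(real DIM(real^'n) - a - b - 1) / 2\<bar> * (LINT x|lborel. (U n x)\<^sup>2 / norm x powr (a + b + 1))"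
      have "?d \<longlonglongrightarrow> sqrt (LINT x|lebesgue. \<bar>u x\<bar>\<^sup>2 / norm x powr (2 * a)) *
          sqrt (LINT x|lebesgue. (norm (Du x))\<^sup>2 / norm x powr (2 * b))
          - \<bar>(real DIM(real^'n) - a - b - 1) / 2\<bar> * (LINT x|lebesgue. \<bar>u x\<bar>\<^sup>2 / norm x powr (a + b + 1))"
        using ab by (intro tendsto_intros lim) auto
      then have d: "?d \<longlonglongrightarrow> delta1 a b u Du" by (simp add: delta1_def)
      have E: "v \<in> borel_measurable lebesgue \<and> integrable lebesgue (\<lambda>x. (v x)\<^sup>2 / norm x powr (a + b + 1))"
        if "v \<in> E_set a b" for v :: "real^'n \<Rightarrow> real"
        using that int_e[of _ "a + b + 1"] meas_e[of _ "a + b + 1"] ab unfolding E_set_def by auto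
      have "(INF v\<in>E_set a b. LINT x|lebesgue. \<bar>u x - v x\<bar>\<^sup>2 / norm x powr (a + b + 1)) \<le> 2 * C * delta1 a b u Du"
      proof (rule stability_limit[OF _ u _ _ _ lim(2) d])
        show "U n \<in> borel_measurable lebesgue" for n by (rule rapid_measurable_lebesgue[OF rapid])
        show "integrable lebesgue (\<lambda>x. (norm (U n x))\<^sup>2 / norm x powr (a + b + 1))" for n
          using rapid_integrable_U[OF rapid[of n], of "a + b + 1"] rapid_measurable[OF rapid[of n]] ab
          by (simp add: integrable_completion)
        show "\<exists>v\<in>E_set a b. (LINT x|lebesgue. (U n x - v x)\<^sup>2 / norm x powr (a + b + 1)) \<le> C * ?d n" for n
        proof -
          obtain \<alpha> \<beta> where "\<beta> > 0"
            "(LINT x|lborel. (U n x - \<alpha> * ?e \<beta> x)\<^sup>2 / norm x powr (a + b + 1)) \<le> C * ?d n"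
            using stab[OF rapid[of n]] by blast
          then show ?thesis
            unfolding lborel[OF rapid[of n], symmetric]
            by (intro bexI[of _ "\<lambda>x. \<alpha> * ?e \<beta> x"]) (auto simp: E_set_def)
        qed
      qed (use ab E in auto)
      then show ?thesis using C by (simp add: field_simps)
    qed
    then show "\<exists>C2>0. \<forall>(u :: real^'n \<Rightarrow> real, Du) \<in> X_space a b.
            delta1 a b u Du
            \<ge> C2 * (INF v\<in>E_set a b. LINT x|lebesgue.
                 \<bar>u x - v x\<bar>\<^sup>2 / norm x powr (a + b + 1))"
      using C by (intro exI[of _ "1 / (2 * C)"] conjI ballI) (simp, fast)
  qed
qed

end
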